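(* Let $\theta_0^{\mathrm{AUC}}:=\int\Pr(R>\alpha\mid Y=1)\,d\Pr(R\le\alpha\mid Y=0)$, with probabilities taken under the full data distribution. Define $$\hat\theta_{C/\pi(X)}:=\int(1-F_{C/\pi(X),1}(\alpha))\,dF_{C/\pi(X),0}(\alpha),\quad \hat\theta^f_{C/\pi(X)}:=\int(1-F^f_{C/\pi(X),1}(\alpha))\,dF^f_{C/\pi(X),0}(\alpha),\quad \hat\theta^f:=\int(1-F^f_1(\alpha))\,dF^f_0(\alpha),$$ where $$F_{C/\pi(X),1}(\alpha):=\frac{\sum_{i=1}^{n+N}\frac{C_i}{\pi(X_i)}I(R_i\le\alpha)Y_i}{\sum_{i=1}^{n+N}\frac{C_i}{\pi(X_i)}Y_i},\qquad F_{C/\pi(X),0}(\alpha):=\frac{\sum_{i=1}^{n+N}\frac{C_i}{\pi(X_i)}I(R_i\le\alpha)(1-Y_i)}{\sum_{i=1}^{n+N}\frac{C_i}{\pi(X_i)}(1-Y_i)},$$ $$F^f_{C/\pi(X),1}(\alpha):=\frac{\sum_{i=1}^{n+N}\frac{C_i}{\pi(X_i)}I(R_i\le\alpha)f(X_i)}{\sum_{i=1}^{n+N}\frac{C_i}{\pi(X_i)}f(X_i)},\qquad F^f_{C/\pi(X),0}(\alpha):=\frac{\sum_{i=1}^{n+N}\frac{C_i}{\pi(X_i)}I(R_i\le\alpha)(1-f(X_i))}{\sum_{i=1}^{n+N}\frac{C_i}{\pi(X_i)}(1-f(X_i))},$$ $$F^f_1(\alpha):=\frac{\sum_{i=1}^{n+N}I(R_i\le\alpha)f(X_i)}{\sum_{i=1}^{n+N}f(X_i)},\qquad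 F^f_0(\alpha):=\frac{\sum_{i=1}^{n+N}I(R_i\le\alpha)(1-f(X_i))}{\sum_{i=1}^{n+N}(1-f(X_i))}.$$ Suppose $$\hat\omega\xrightarrow{p}\frac{\operatorname{Cov}\left(\frac{C_i}{\pi(X_i)}\phi^{\mathrm{AUC}}(R_i,Y_i),\ \Big(\frac{C_i}{\pi(X_i)}-1\Big)\phi^{\mathrm{AUC}}(R_i,f(X_i))\right)}{\operatorname{Var}\left(\Big(1-\frac{C_i}{\pi(X_i)}\Big)\phi^{\mathrm{AUC}}(R_i,f(X_i))\right)},$$ with $\phi^{\mathrm{AUC}}$ as in the context, and define $\hat\theta:=\hat\theta_{C/\pi(X)}+\hat\omega\big(\hat\theta^f-\hat\theta^f_{C/\pi(X)}\big)$. Assume that $(X_i,C_i,Y_i)_{i=1}^{n+N}$ are i.i.d., that $C$ is conditionally independent of $Y$ given $X$, and that $\epsilon<\pi(X)<1-\epsilon$ for some $\epsilon>0$. Then $$\sqrt{n+N}\,\big(\hat\theta-\theta_0^{\mathrm{AUC}}\big)\xrightarrow{d}N(0,\sigma^2),$$ where $$\sigma^2=\operatorname{Var}\left(\frac{C_i}{\pi(X_i)}\phi^{\mathrm{AUC}}(R_i,Y_i)\right)-\frac{\operatorname{Cov}\left(\frac{C_i}{\pi(X_i)}\phi^{\mathrm{AUC}}(R_i,Y_i),\ \Big(1-\frac{C_i}{\pi(X_i)}\Big)\phi^{\mathrm{AUC}}(R_i,f(X_i))\right)^2}{\operatorname{Var}\left(\Big(1-\frac{C_i}{\pi(X_i)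}\Big)\phi^{\mathrm{AUC}}(R_i,f(X_i))\right)}.$$
   Context: Setting: $(X,C,Y)\sim\mathbb Q^*$ (the full data distribution), $Y\in\{0,1\}$, and $C\in\{0,1\}$ is the indicator that $Y$ is observed; the observed data are $(X_i,C_i,C_iY_i)_{i=1}^{n+N}$. $R$ is a biomarker, one of the elements of the vector $X$. $\pi(X)=\Pr(C=1\mid X)$ is known. $f$ is a deterministic prediction model with $f(X)\ge0$ and $\mathbb E[f(X)]\big(1-\mathbb E[f(X)]\big)\ne0$. Integrals are Stieltjes integrals in the threshold $\alpha$, and $I(\cdot)$ is the indicator function. With expectations under $\mathbb Q^*$, $$\phi^{\mathrm{AUC}}(R_i,Y_i)=\frac{1-Y_i}{\mathbb E[1-Y]}\left(1-\frac{\mathbb E[I(R\le\alpha)Y]}{\mathbb E[Y]}\right)\bigg|_{\alpha=R_i}+\frac{Y_i}{\mathbb E[Y]}\,\frac{\mathbb E[I(R\le\alpha)(1-Y)]}{\mathbb E[1-Y]}\bigg|_{\alpha=R_i}-\left(\frac{1-Y_i}{\mathbb E[1-Y]}+\frac{Y_i}{\mathbb E[Y]}\right)\int\frac{\mathbb E[I(R>\alpha)Y]}{\mathbb E[Y]}\,d\left(\frac{\mathbb E[I(R\le\alpha)(1-Y)]}{\mathbb E[1-Y]}\right),$$ and $\phi^{\mathrm{AUC}}(R_i,f(X_i))$ is the same expression with $Y_i$ replaced by $f(X_i)$ and $Y$ replaced by $f(X)$ throughout (including inside all expectations).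
   Formalization: Two assumptions are added: E[f(X)²] is finite (else the variances may be undefined), and Pr(R≤α|Y=1), Pr(R≤α|Y=0) share no jump, likewise their f-weighted versions; with shared jumps the claim fails (R, Y, C fair independent coins, f=1/2: formula gives 1, true variance 1/2). *)

theory Defs
  imports "HOL-Probability.Probability"
begin

section \<open>Lebesgue--Stieltjes integrals\<close>

text \<open>
  The integrators that occur are differences of right-continuous nondecreasing functions, but need
  not be monotone themselves: the weights \<open>1 - f(X)\<close> may be negative. So \<open>F\<close> is split as \<open>P - N\<close>
  and integrated against the two associated Lebesgue--Stieltjes measures.
\<close>

definition has_stieltjes_integral :: "(real \<Rightarrow> real) \<Rightarrow> (real \<Rightarrow> real) \<Rightarrow> real \<Rightarrow> bool" where
  "has_stieltjes_integral g F I \<longleftrightarrow>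
     (\<exists>P N. mono P \<and> mono N \<and>
        (\<forall>a. continuous (at_right a) P) \<and> (\<forall>a. continuous (at_right a) N) \<and>
        F = (\<lambda>a. P a - N a) \<and>
        integrable (interval_measure P) g \<and> integrable (interval_measure N) g \<and>
        I = (\<integral>a. g a \<partial>interval_measure P) - (\<integral>a. g a \<partial>interval_measure N))"

definition stieltjes_integral :: "(real \<Rightarrow> real) \<Rightarrow> (real \<Rightarrow> real) \<Rightarrow> real" where
  "stieltjes_integral g F = (THE I. has_stieltjes_integral g F I)"

text \<open>The value does not depend on the decomposition.\<close>

lemma emeasure_interval_measure_add:
  assumes P: "mono P" "\<And>a. continuous (at_right a) P"
      and N: "mono N" "\<And>a. continuous (at_right a) N"
      and A: "A \<in> sets borel"
  shows "emeasure (interval_measure (\<lambda>a. P a + N a)) A =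
           emeasure (interval_measure P) A + emeasure (interval_measure N) A"
proof -
  let ?S = "interval_measure (\<lambda>a. P a + N a)"
  let ?\<nu> = "\<lambda>A. emeasure (interval_measure P) A + emeasure (interval_measure N) A"
  let ?T = "measure_of UNIV (sets borel) ?\<nu>"
  have T: "emeasure ?T A = ?\<nu> A" if "A \<in> sets borel" for A
  proof (rule emeasure_measure_of_sigma)
    show "sigma_algebra UNIV (sets (borel :: real measure))"
      using sets.sigma_algebra_axioms[of "borel :: real measure"] by simp
    show "positive (sets borel) ?\<nu>" by (simp add: positive_def)
    show "countably_additive (sets borel) ?\<nu>"
    proof (rule countably_additiveI)
      fix B :: "nat \<Rightarrow> real set"
      assume B: "range B \<subseteq> sets borel" "disjoint_family B" "(\<Union>i. B i) \<in> sets borel"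
      then show "(\<Sum>i. ?\<nu> (B i)) = ?\<nu> (\<Union>i. B i)"
        by (simp add: suminf_add[symmetric] suminf_emeasure)
    qed
    show "A \<in> sets borel" by fact
  qed
  have sT: "sets ?T = sets borel"
    using sets.sigma_sets_eq[of "borel :: real measure"] by (simp add: sets_measure_of)
  have mPN: "P a + N a \<le> P b + N b" if "a \<le> b" for a b
    using that P(1) N(1) by (meson add_mono monoD)
  have ioc: "emeasure ?S {a<..b} = ?\<nu> {a<..b}" if "a \<le> b" for a b
  proof -
    have "emeasure ?S {a<..b} = ennreal ((P b + N b) - (P a + N a))"
      by (rule emeasure_interval_measure_Ioc)
         (use that mPN P(2) N(2) in \<open>auto intro!: continuous_add\<close>)
    also have "\<dots> = ennreal (P b - P a) + ennreal (N b - N a)"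
      using that P(1) N(1) by (subst ennreal_plus[symmetric]) (auto simp: monoD algebra_simps)
    also have "\<dots> = ?\<nu> {a<..b}"
      using that P N by (subst (1 2) emeasure_interval_measure_Ioc) (auto dest: monoD)
    finally show ?thesis .
  qed
  have "?S = ?T"
  proof (rule measure_eqI_generator_eq[where E = "range (\<lambda>(a, b). {a<..b::real})" and \<Omega> = UNIV
        and A = "\<lambda>i::nat. {- real i<..real i}"])
    show "Int_stable (range (\<lambda>(a, b). {a<..b::real}))"
      by (auto simp: Int_stable_def)
    show "emeasure ?S X = emeasure ?T X" if X: "X \<in> range (\<lambda>(a, b). {a<..b::real})" for X
    proof -
      obtain a b where X: "X = {a<..b}" using X by auto
      show ?thesis
        by (cases "a \<le> b") (simp_all add: X T ioc)
    qed
    show "sets ?S = sigma_sets UNIV (range (\<lambda>(a, b). {a<..b::real}))"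
      by (simp add: borel_sigma_sets_Ioc)
    then show "sets ?T = sigma_sets UNIV (range (\<lambda>(a, b). {a<..b::real}))"
      using sT by simp
    show "(\<Union>i. {- real i<..real i}) = UNIV"
    proof -
      have "x \<in> (\<Union>i. {- real i<..real i})" for x :: real
      proof -
        obtain n where "\<bar>x\<bar> < real n" using reals_Archimedean2 by blast
        then show ?thesis by (intro UN_I[of n]) auto
      qed
      then show ?thesis by blast
    qed
    show "emeasure ?S {- real i<..real i} \<noteq> \<infinity>" for i :: nat
      using ioc[of "- real i" "real i"] P N
      by (subst emeasure_interval_measure_Ioc) (auto intro!: mPN continuous_add)
  qed auto
  then show ?thesis using T[OF A] by simp
qed

lemma nn_integral_interval_measure_add:
  assumes P: "mono P" "\<And>a. continuous (at_right a) P"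
      and N: "mono N" "\<And>a. continuous (at_right a) N"
      and u: "u \<in> borel_measurable borel"
  shows "(\<integral>\<^sup>+a. u a \<partial>interval_measure (\<lambda>a. P a + N a)) =
           (\<integral>\<^sup>+a. u a \<partial>interval_measure P) + (\<integral>\<^sup>+a. u a \<partial>interval_measure N)"
  using u
proof (induction rule: borel_measurable_induct)
  case (cong f g) then show ?case by simp
next
  case (set A)
  then show ?case by (simp add: emeasure_interval_measure_add[OF P N])
next
  case (mult u c)
  then show ?case by (simp add: nn_integral_cmult distrib_left)
next
  case (add u v)
  then show ?case by (simp add: nn_integral_add ac_simps)
next
  case (seq U)
  have *: "(\<integral>\<^sup>+a. (SUP i. U i) a \<partial>interval_measure F) =
      (SUP i. \<integral>\<^sup>+a. U i a \<partial>interval_measure F)" for F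
    unfolding SUP_apply
    by (rule nn_integral_monotone_convergence_SUP) (use seq in auto)
  have inc: "incseq (\<lambda>i. \<integral>\<^sup>+a. U i a \<partial>interval_measure F)" for F
    using seq(3) by (auto simp: incseq_def le_fun_def intro!: nn_integral_mono)
  show ?case
    using seq(5) unfolding * by (subst ennreal_SUP_add[OF inc inc, symmetric]) simp
qed

lemma integral_interval_measure_add:
  fixes g :: "real \<Rightarrow> real"
  assumes P: "mono P" "\<And>a. continuous (at_right a) P"
      and N: "mono N" "\<And>a. continuous (at_right a) N"
      and g: "integrable (interval_measure P) g" "integrable (interval_measure N) g"
  shows "(\<integral>a. g a \<partial>interval_measure (\<lambda>a. P a + N a)) =
           (\<integral>a. g a \<partial>interval_measure P) + (\<integral>a. g a \<partial>interval_measure N)"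
proof -
  have gm: "g \<in> borel_measurable borel"
    using g(1) by (auto dest: borel_measurable_integrable)
  let ?p = "\<lambda>F. \<integral>\<^sup>+a. ennreal (g a) \<partial>interval_measure F"
  let ?n = "\<lambda>F. \<integral>\<^sup>+a. ennreal (- g a) \<partial>interval_measure F"
  have p: "?p (\<lambda>a. P a + N a) = ?p P + ?p N"
    and n: "?n (\<lambda>a. P a + N a) = ?n P + ?n N"
    using gm by (auto intro!: nn_integral_interval_measure_add[OF P N])
  have fin: "?p P \<noteq> \<infinity>" "?n P \<noteq> \<infinity>" "?p N \<noteq> \<infinity>" "?n N \<noteq> \<infinity>"
    using g by (auto simp: real_integrable_def)
  have "integrable (interval_measure (\<lambda>a. P a + N a)) g"
    using gm fin by (simp add: real_integrable_def p n)
  then show ?thesis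
    using g fin by (simp add: real_lebesgue_integral_def p n enn2real_plus less_top)
qed

lemma has_stieltjes_integral_unique:
  assumes "has_stieltjes_integral g F I" "has_stieltjes_integral g F J"
  shows "I = J"
proof -
  obtain P N where 1: "mono P" "mono N" "\<forall>a. continuous (at_right a) P"
      "\<forall>a. continuous (at_right a) N"
      "integrable (interval_measure P) g" "integrable (interval_measure N) g"
    and F: "F = (\<lambda>a. P a - N a)"
    and I: "I = (\<integral>a. g a \<partial>interval_measure P) - (\<integral>a. g a \<partial>interval_measure N)"
    using assms(1) unfolding has_stieltjes_integral_def by (elim exE conjE)
  obtain P' N' where 2: "mono P'" "mono N'" "\<forall>a. continuous (at_right a) P'"
      "\<forall>a. continuous (at_right a) N'"
      "integrable (interval_measure P') g" "integrable (interval_measure N') g"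
    and F': "F = (\<lambda>a. P' a - N' a)"
    and J: "J = (\<integral>a. g a \<partial>interval_measure P') - (\<integral>a. g a \<partial>interval_measure N')"
    using assms(2) unfolding has_stieltjes_integral_def by (elim exE conjE)
  have eq: "(\<lambda>a. P a + N' a) = (\<lambda>a. P' a + N a)"
  proof
    fix a show "P a + N' a = P' a + N a"
      using fun_cong[OF trans[OF F[symmetric] F'], of a] by simp
  qed
  have "(\<integral>a. g a \<partial>interval_measure P) + (\<integral>a. g a \<partial>interval_measure N') =
        (\<integral>a. g a \<partial>interval_measure P') + (\<integral>a. g a \<partial>interval_measure N)"
    using integral_interval_measure_add[of P N' g] integral_interval_measure_add[of P' N g] 1 2
    unfolding eq by metis
  then show ?thesis using I J by linarith
qed

lemma stieltjes_integral_eqI: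
  "has_stieltjes_integral g F I \<Longrightarrow> stieltjes_integral g F = I"
  unfolding stieltjes_integral_def by (blast intro: the_equality has_stieltjes_integral_unique)


section \<open>Probabilistic notions\<close>

definition covariance :: "'q measure \<Rightarrow> ('q \<Rightarrow> real) \<Rightarrow> ('q \<Rightarrow> real) \<Rightarrow> real" where
  "covariance Q U V =
     (\<integral>z. (U z - (\<integral>y. U y \<partial>Q)) * (V z - (\<integral>y. V y \<partial>Q)) \<partial>Q)"

definition converges_in_prob :: "'a measure \<Rightarrow> (nat \<Rightarrow> 'a \<Rightarrow> real) \<Rightarrow> real \<Rightarrow> bool" where
  "converges_in_prob M Z c \<longleftrightarrow>
     (\<forall>e>0. (\<lambda>m. \<P>(w in M. \<bar>Z m w - c\<bar> > e)) \<longlonglongrightarrow> 0)"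

text \<open>For \<open>v = 0\<close> this is the point mass at \<open>\<mu>\<close>, whereas \<open>normal_density \<mu> 0\<close> is identically zero.\<close>

definition normal_law :: "real \<Rightarrow> real \<Rightarrow> real measure" where
  "normal_law \<mu> v = distr std_normal_distribution borel (\<lambda>x. \<mu> + sqrt v * x)"

definition cond_prob_given :: "'q measure \<Rightarrow> ('q \<Rightarrow> 'x::topological_space) \<Rightarrow> 'q set \<Rightarrow> 'q \<Rightarrow> real" where
  "cond_prob_given Q X A = real_cond_exp Q (vimage_algebra (space Q) X borel) (indicator A)"

definition cond_indep_given ::
    "'q measure \<Rightarrow> ('q \<Rightarrow> real) \<Rightarrow> ('q \<Rightarrow> real) \<Rightarrow> ('q \<Rightarrow> 'x::topological_space) \<Rightarrow> bool" where
  "cond_indep_given Q U V X \<longleftrightarrow>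
     (\<forall>A\<in>sets borel. \<forall>B\<in>sets borel. AE z in Q.
        cond_prob_given Q X {y \<in> space Q. U y \<in> A \<and> V y \<in> B} z =
        cond_prob_given Q X {y \<in> space Q. U y \<in> A} z * cond_prob_given Q X {y \<in> space Q. V y \<in> B} z)"


section \<open>The area under the curve\<close>

definition auc :: "(real \<Rightarrow> real) \<Rightarrow> (real \<Rightarrow> real) \<Rightarrow> real" where
  "auc F1 F0 = stieltjes_integral (\<lambda>\<alpha>. 1 - F1 \<alpha>) F0"

definition wcdf :: "nat \<Rightarrow> (nat \<Rightarrow> real) \<Rightarrow> (nat \<Rightarrow> real) \<Rightarrow> (nat \<Rightarrow> real) \<Rightarrow> real \<Rightarrow> real" where
  "wcdf m w R T \<alpha> = (\<Sum>i<m. w i * indicator {..\<alpha>} (R i) * T i) / (\<Sum>i<m. w i * T i)"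

definition auc_hat :: "nat \<Rightarrow> (nat \<Rightarrow> real) \<Rightarrow> (nat \<Rightarrow> real) \<Rightarrow> (nat \<Rightarrow> real) \<Rightarrow> real" where
  "auc_hat m w R T = auc (wcdf m w R T) (wcdf m w R (\<lambda>i. 1 - T i))"

definition pop_wcdf :: "'q measure \<Rightarrow> ('q \<Rightarrow> real) \<Rightarrow> ('q \<Rightarrow> real) \<Rightarrow> real \<Rightarrow> real" where
  "pop_wcdf Q R T \<alpha> = (\<integral>z. indicator {..\<alpha>} (R z) * T z \<partial>Q) / (\<integral>z. T z \<partial>Q)"

text \<open>\<open>phi_auc Q R T \<rho> t\<close> is \<open>\<phi>\<^sup>A\<^sup>U\<^sup>C(\<rho>, t)\<close>, where \<open>T\<close> is the variable inside the expectations
  (\<open>Y\<close> or \<open>f(X)\<close>) and \<open>t\<close> its value at the observation.\<close>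

definition phi_auc :: "'q measure \<Rightarrow> ('q \<Rightarrow> real) \<Rightarrow> ('q \<Rightarrow> real) \<Rightarrow> real \<Rightarrow> real \<Rightarrow> real" where
  "phi_auc Q R T \<rho> t =
     (1 - t) / (\<integral>z. 1 - T z \<partial>Q) * (1 - pop_wcdf Q R T \<rho>)
     + t / (\<integral>z. T z \<partial>Q) * pop_wcdf Q R (\<lambda>z. 1 - T z) \<rho>
     - ((1 - t) / (\<integral>z. 1 - T z \<partial>Q) + t / (\<integral>z. T z \<partial>Q)) *
       stieltjes_integral
         (\<lambda>\<alpha>. (\<integral>z. indicator {\<alpha><..} (R z) * T z \<partial>Q) / (\<integral>z. T z \<partial>Q))
         (pop_wcdf Q R (\<lambda>z. 1 - T z))"

end

theory Submission
  imports Defs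
begin

text \<open>
  With kernel weights \<open>a = w T\<close> and \<open>b = w (1 - T)\<close>, each of the three estimated AUCs is, off an event of
  vanishing probability, the ratio of the V-statistic \<open>m\<^sup>-\<^sup>2 \<Sum>\<^sub>i\<^sub>j a\<^sub>i b\<^sub>j I(R\<^sub>j < R\<^sub>i)\<close> and the product of the sample
  means of \<open>a\<close> and \<open>b\<close>. The degenerate part of the Hoeffding decomposition of the V-statistic has second
  moment \<open>O(m\<^sup>-\<^sup>2)\<close>, so \<open>\<surd>m\<close> times the centred ratio equals \<open>m\<^sup>-\<^sup>1\<^sup>/\<^sup>2 \<Sum>\<^sub>i w\<^sub>i \<phi>(R\<^sub>i, T\<^sub>i)\<close> up to \<open>o\<^sub>p(1)\<close>, provided that the
  weights are unbiased. Missingness at random gives unbiasedness for \<open>w = C/\<pi>(X)\<close>. By Slutsky's lemma the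
  estimator \<open>\<theta>_hat\<close> then has influence function \<open>A + \<omega> B\<close> with \<open>\<omega> = - Cov(A, B) / Var B\<close>, whose variance is \<open>\<sigma>2\<close>;
  if \<open>Var B = 0\<close>, both quotients are \<open>0\<close> in Isabelle and the same formula holds.
\<close>

section \<open>Convergence in probability\<close>

text \<open>The last term of \<open>phi_auc\<close> stems from the random denominators. If
  \<open>P1\<close> and \<open>P0\<close> are the limits of the two sample means and
  \<open>\<theta> * (P1 * P0)\<close> equals the mean \<open>\<mu>\<close> of the kernel, then, up
  to the factor \<open>1 / (P1 * P0)\<close>, expanding the quotient to first order subtracts
  \<open>\<theta> * (P0 * a + P1 * b)\<close> from the projection of the V-statistic. A single
  linearisation lemma serves all three estimators, with weight and outcome
  (\<open>C / \<pi>\<close>, \<open>Y\<close>), (1, \<open>f\<close>) and (\<open>C / \<pi>\<close>,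
  \<open>f\<close>). As \<open>f\<close> may exceed 1, the weights 1 - \<open>f\<close> can be
  negative and the weighted distribution functions need not be monotone; the estimates therefore
  rest on square integrability, and the sign of the outcome enters only where ties of
  \<open>R\<close> are discussed. Population and sample live on unrelated probability spaces
  \<open>Q\<close> and \<open>M\<close>, so both are transported to the law \<open>D\<close> of one
  triple (X, C, Y), on which influence functions are plain integrands. Remainders are controlled by
  second moments; characteristic functions appear only in Slutsky's lemma and in the central limit
  theorem.\<close>

definition bounded_in_prob :: "'a measure \<Rightarrow> (nat \<Rightarrow> 'a \<Rightarrow> real) \<Rightarrow> bool" where
  "bounded_in_prob M Z \<longleftrightarrow>
     (\<forall>e>0. \<exists>K>0. \<forall>\<^sub>F m in sequentially. \<P>(w in M. \<bar>Z m w\<bar> > K) < e)"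

context prob_space
begin

lemma converges_in_probI_le:
  assumes "\<And>e. e > 0 \<Longrightarrow> \<exists>u. u \<longlonglongrightarrow> 0 \<and> (\<forall>\<^sub>F m in sequentially. \<P>(w in M. \<bar>Z m w - c\<bar> > e) \<le> u m)"
  shows "converges_in_prob M Z c"
  unfolding converges_in_prob_def
proof (intro allI impI)
  fix e :: real assume "e > 0"
  then obtain u where u: "u \<longlonglongrightarrow> 0" "\<forall>\<^sub>F m in sequentially. \<P>(w in M. \<bar>Z m w - c\<bar> > e) \<le> u m"
    using assms by blast
  show "(\<lambda>m. \<P>(w in M. \<bar>Z m w - c\<bar> > e)) \<longlonglongrightarrow> 0"
    by (rule tendsto_sandwich[OF _ u(2) tendsto_const u(1)]) simp
qed

lemma converges_in_probD:
  "converges_in_prob M Z c \<Longrightarrow> e > 0 \<Longrightarrow> (\<lambda>m. \<P>(w in M. \<bar>Z m w - c\<bar> > e)) \<longlonglongrightarrow> 0"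
  unfolding converges_in_prob_def by blast

lemma prob_le_add:
  assumes [measurable]: "Measurable.pred M P" "Measurable.pred M P1" "Measurable.pred M P2"
    and "\<And>w. w \<in> space M \<Longrightarrow> P w \<Longrightarrow> P1 w \<or> P2 w"
  shows "\<P>(w in M. P w) \<le> \<P>(w in M. P1 w) + \<P>(w in M. P2 w)"
proof -
  have "\<P>(w in M. P w) \<le> prob ({w \<in> space M. P1 w} \<union> {w \<in> space M. P2 w})"
    using assms(4) by (intro finite_measure_mono) auto
  also have "\<dots> \<le> \<P>(w in M. P1 w) + \<P>(w in M. P2 w)"
    by (intro measure_Un_le) auto
  finally show ?thesis .
qed

lemma converges_in_prob_add:
  assumes [measurable]: "\<And>m. Z m \<in> borel_measurable M" "\<And>m. W m \<in> borel_measurable M"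
    and Z: "converges_in_prob M Z a" and W: "converges_in_prob M W b"
  shows "converges_in_prob M (\<lambda>m w. Z m w + W m w) (a + b)"
proof (rule converges_in_probI_le)
  fix e :: real assume "e > 0"
  then have "(\<lambda>m. \<P>(w in M. \<bar>Z m w - a\<bar> > e/2) + \<P>(w in M. \<bar>W m w - b\<bar> > e/2)) \<longlonglongrightarrow> 0 + 0"
    by (intro tendsto_add converges_in_probD Z W) auto
  moreover have "\<P>(w in M. \<bar>Z m w + W m w - (a + b)\<bar> > e)
      \<le> \<P>(w in M. \<bar>Z m w - a\<bar> > e/2) + \<P>(w in M. \<bar>W m w - b\<bar> > e/2)" for m
    by (rule prob_le_add) (auto simp: abs_if split: if_splits)
  ultimately show "\<exists>u. u \<longlonglongrightarrow> 0 \<and>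
      (\<forall>\<^sub>F m in sequentially. \<P>(w in M. \<bar>Z m w + W m w - (a + b)\<bar> > e) \<le> u m)"
    by auto
qed

text \<open>Continuous mapping at a constant limit: a large deviation of \<open>g (Z m w)\<close>
  forces \<open>Z m w\<close> out of a fixed neighbourhood of \<open>c\<close>.\<close>

lemma converges_in_prob_isCont:
  assumes [measurable]: "\<And>m. Z m \<in> borel_measurable M"
    and Z: "converges_in_prob M Z c" and g: "isCont g c"
  shows "converges_in_prob M (\<lambda>m w. g (Z m w)) (g c)"
proof (rule converges_in_probI_le)
  fix e :: real assume "e > 0"
  then obtain d where d: "d > 0" "\<And>x. \<bar>x - c\<bar> < d \<Longrightarrow> \<bar>g x - g c\<bar> < e"
    using g unfolding continuous_at_eps_delta dist_real_def by meson
  \<comment> \<open>Continuity only yields \<open>\<bar>Z m w - c\<bar> \<ge> d\<close>; halving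
    \<open>d\<close> gives the strict inequality used in \<open>converges_in_prob\<close>.\<close>
  have "\<P>(w in M. \<bar>g (Z m w) - g c\<bar> > e) \<le> \<P>(w in M. \<bar>Z m w - c\<bar> > d/2)" for m
  proof (intro finite_measure_mono subsetI CollectI conjI)
    fix w assume w: "w \<in> {w \<in> space M. \<bar>g (Z m w) - g c\<bar> > e}"
    then show "w \<in> space M" by simp
    show "\<bar>Z m w - c\<bar> > d/2"
      using w d(1) d(2)[of "Z m w"] by (smt (verit) mem_Collect_eq field_sum_of_halves)
  qed measurable
  moreover have "(\<lambda>m. \<P>(w in M. \<bar>Z m w - c\<bar> > d/2)) \<longlonglongrightarrow> 0"
    using d(1) by (intro converges_in_probD Z) auto
  ultimately show "\<exists>u. u \<longlonglongrightarrow> 0 \<and>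
      (\<forall>\<^sub>F m in sequentially. \<P>(w in M. \<bar>g (Z m w) - g c\<bar> > e) \<le> u m)"
    by auto
qed

lemma converges_in_prob_cmult:
  assumes "\<And>m. Z m \<in> borel_measurable M" "converges_in_prob M Z c"
  shows "converges_in_prob M (\<lambda>m w. k * Z m w) (k * c)"
  by (rule converges_in_prob_isCont[OF assms]) (auto intro!: continuous_intros)

lemma converges_in_prob_diff:
  assumes [measurable]: "\<And>m. Z m \<in> borel_measurable M" "\<And>m. W m \<in> borel_measurable M"
    and Z: "converges_in_prob M Z a" and W: "converges_in_prob M W b"
  shows "converges_in_prob M (\<lambda>m w. Z m w - W m w) (a - b)"
  using converges_in_prob_add[OF assms(1) _ Z converges_in_prob_cmult[OF _ W, of "-1"]] by simp

lemma bounded_in_prob_of_converges: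
  assumes [measurable]: "\<And>m. Z m \<in> borel_measurable M" and Z: "converges_in_prob M Z c"
  shows "bounded_in_prob M Z"
  unfolding bounded_in_prob_def
proof (intro allI impI exI conjI)
  fix e :: real assume "e > 0"
  show "0 < \<bar>c\<bar> + 1" by simp
  have *: "\<P>(w in M. \<bar>Z m w\<bar> > \<bar>c\<bar> + 1) \<le> \<P>(w in M. \<bar>Z m w - c\<bar> > 1)" for m
    by (intro finite_measure_mono) auto
  have "\<forall>\<^sub>F m in sequentially. \<P>(w in M. \<bar>Z m w - c\<bar> > 1) < e"
    using converges_in_probD[OF Z, of 1] \<open>e > 0\<close> by (auto dest: order_tendstoD)
  then show "\<forall>\<^sub>F m in sequentially. \<P>(w in M. \<bar>Z m w\<bar> > \<bar>c\<bar> + 1) < e"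
    by eventually_elim (use * le_less_trans in blast)
qed

text \<open>The rule o_p(1) times O_p(1) is o_p(1): if the product exceeds \<open>e\<close>, then
  either \<open>W\<close> exceeds its probabilistic bound \<open>K\<close> or \<open>Z\<close>
  exceeds \<open>e / K\<close>.\<close>

lemma converges_in_prob_mult_bounded:
  assumes [measurable]: "\<And>m. Z m \<in> borel_measurable M" "\<And>m. W m \<in> borel_measurable M"
    and Z: "converges_in_prob M Z 0" and W: "bounded_in_prob M W"
  shows "converges_in_prob M (\<lambda>m w. Z m w * W m w) 0"
  unfolding converges_in_prob_def
proof (intro allI impI)
  fix e :: real assume e: "e > 0"
  show "(\<lambda>m. \<P>(w in M. \<bar>Z m w * W m w - 0\<bar> > e)) \<longlonglongrightarrow> 0"
  proof (rule order_tendstoI)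
    fix d :: real assume d: "0 < d"
    then obtain K where K: "K > 0" "\<forall>\<^sub>F m in sequentially. \<P>(w in M. \<bar>W m w\<bar> > K) < d/2"
      using W unfolding bounded_in_prob_def by (meson half_gt_zero)
    have "\<forall>\<^sub>F m in sequentially. \<P>(w in M. \<bar>Z m w - 0\<bar> > e/K) < d/2"
      using e K(1) d by (intro order_tendstoD(2)[OF converges_in_probD[OF Z]]) auto
    with K(2) show "\<forall>\<^sub>F m in sequentially. \<P>(w in M. \<bar>Z m w * W m w - 0\<bar> > e) < d"
    proof eventually_elim
      case (elim m)
      have "\<P>(w in M. \<bar>Z m w * W m w - 0\<bar> > e)
          \<le> \<P>(w in M. \<bar>Z m w - 0\<bar> > e/K) + \<P>(w in M. \<bar>W m w\<bar> > K)"
      proof (rule prob_le_add)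
        fix w assume "\<bar>Z m w * W m w - 0\<bar> > e"
        then have *: "e < \<bar>Z m w\<bar> * \<bar>W m w\<bar>" by (simp add: abs_mult)
        have "\<bar>Z m w\<bar> * \<bar>W m w\<bar> \<le> (e/K) * K" if "\<bar>Z m w\<bar> \<le> e/K" "\<bar>W m w\<bar> \<le> K"
          using that by (intro mult_mono) (use e K(1) in auto)
        with * K(1) show "\<bar>Z m w - 0\<bar> > e/K \<or> \<bar>W m w\<bar> > K" by force
      qed measurable
      with elim show ?case by simp
    qed
  qed (rule always_eventually, use less_le_trans[OF _ measure_nonneg] in blast)
qed

lemma converges_in_prob_mult:
  assumes [measurable]: "\<And>m. Z m \<in> borel_measurable M" "\<And>m. W m \<in> borel_measurable M"
    and Z: "converges_in_prob M Z a" and W: "converges_in_prob M W b"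
  shows "converges_in_prob M (\<lambda>m w. Z m w * W m w) (a * b)"
proof -
  have const: "converges_in_prob M (\<lambda>m w. k) k" for k
    by (auto simp: converges_in_prob_def)
  have "converges_in_prob M (\<lambda>m w. Z m w - a) 0"
    using converges_in_prob_diff[OF _ _ Z const[of a]] by simp
  then have "converges_in_prob M (\<lambda>m w. (Z m w - a) * W m w) 0"
    by (intro converges_in_prob_mult_bounded bounded_in_prob_of_converges[OF _ W]) auto
  then have "converges_in_prob M (\<lambda>m w. (Z m w - a) * W m w + a * W m w) (0 + a * b)"
    by (intro converges_in_prob_add converges_in_prob_cmult W) auto
  then show ?thesis by (simp add: algebra_simps)
qed

text \<open>This licenses algebra with a random denominator \<open>D\<close>: where \<open>D\<close>
  is zero it lies at distance \<open>\<bar>d\<bar> > \<bar>d\<bar> / 2\<close> from its limit, so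
  the exceptional event has vanishing probability and the value of \<open>Z\<close> there is
  immaterial.\<close>

lemma converges_in_prob_cong_nonzero:
  assumes [measurable]: "\<And>m. Z m \<in> borel_measurable M" "\<And>m. W m \<in> borel_measurable M"
      "\<And>m. D m \<in> borel_measurable M"
    and W: "converges_in_prob M W c" and D: "converges_in_prob M D d" "d \<noteq> 0"
    and eq: "\<And>m w. w \<in> space M \<Longrightarrow> D m w \<noteq> 0 \<Longrightarrow> Z m w = W m w"
  shows "converges_in_prob M Z c"
proof (rule converges_in_probI_le)
  fix e :: real assume "e > 0"
  then have "(\<lambda>m. \<P>(w in M. \<bar>W m w - c\<bar> > e) + \<P>(w in M. \<bar>D m w - d\<bar> > \<bar>d\<bar>/2)) \<longlonglongrightarrow> 0 + 0"
    using D(2) by (intro tendsto_add converges_in_probD W D(1)) auto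
  moreover have "\<P>(w in M. \<bar>Z m w - c\<bar> > e)
      \<le> \<P>(w in M. \<bar>W m w - c\<bar> > e) + \<P>(w in M. \<bar>D m w - d\<bar> > \<bar>d\<bar>/2)" for m
  proof (rule prob_le_add)
    fix w assume "w \<in> space M" "\<bar>Z m w - c\<bar> > e"
    then show "\<bar>W m w - c\<bar> > e \<or> \<bar>D m w - d\<bar> > \<bar>d\<bar>/2"
      using eq[of w m] D(2) by (cases "D m w = 0") auto
  qed measurable
  ultimately show "\<exists>u. u \<longlonglongrightarrow> 0 \<and>
      (\<forall>\<^sub>F m in sequentially. \<P>(w in M. \<bar>Z m w - c\<bar> > e) \<le> u m)"
    by auto
qed

lemma converges_in_prob_of_second_moment:
  assumes [measurable]: "\<And>m. Z m \<in> borel_measurable M"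
    and int: "\<And>m. integrable M (\<lambda>w. (Z m w - c)\<^sup>2)"
    and le: "\<And>m. expectation (\<lambda>w. (Z m w - c)\<^sup>2) \<le> u m" and u: "u \<longlonglongrightarrow> 0"
  shows "converges_in_prob M Z c"
proof (rule converges_in_probI_le)
  fix e :: real assume e: "e > 0"
  have "\<P>(w in M. \<bar>Z m w - c\<bar> > e) \<le> u m / e\<^sup>2" for m
  proof -
    have "\<P>(w in M. \<bar>Z m w - c\<bar> > e) \<le> \<P>(w in M. e\<^sup>2 \<le> (Z m w - c)\<^sup>2)"
      using e by (intro finite_measure_mono subsetI) (auto intro: power2_le_imp_le abs_le_square_iff[THEN iffD1])
    also have "\<dots> \<le> expectation (\<lambda>w. (Z m w - c)\<^sup>2) / e\<^sup>2"
      by (rule integral_Markov_inequality_measure[OF int, of "{}"]) (use e in auto)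
    also have "\<dots> \<le> u m / e\<^sup>2" by (intro divide_right_mono le) auto
    finally show ?thesis .
  qed
  moreover have "(\<lambda>m. u m / e\<^sup>2) \<longlonglongrightarrow> 0" using tendsto_divide[OF u tendsto_const, of "e\<^sup>2"] e by simp
  ultimately show "\<exists>u. u \<longlonglongrightarrow> 0 \<and> (\<forall>\<^sub>F m in sequentially. \<P>(w in M. \<bar>Z m w - c\<bar> > e) \<le> u m)"
    by auto
qed

lemma bounded_in_prob_of_second_moment:
  assumes [measurable]: "\<And>m. Z m \<in> borel_measurable M"
    and int: "\<And>m. integrable M (\<lambda>w. (Z m w)\<^sup>2)"
    and le: "\<And>m. expectation (\<lambda>w. (Z m w)\<^sup>2) \<le> K"
  shows "bounded_in_prob M Z"
  unfolding bounded_in_prob_def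
proof (intro allI impI)
  fix e :: real assume e: "e > 0"
  have "0 \<le> expectation (\<lambda>w. (Z 0 w)\<^sup>2)" by simp
  then have K: "0 \<le> K" using le[of 0] by linarith
  \<comment> \<open>Chebyshev's bound \<open>K / L\<^sup>2\<close> becomes
    \<open>e * K / (K + 1)\<close>; the summand 1 makes it strictly less than \<open>e\<close> and
    keeps \<open>L\<close> positive when \<open>K = 0\<close>.\<close>
  define L where "L = sqrt ((K + 1) / e)"
  have L: "L > 0" "L\<^sup>2 = (K + 1) / e" using K e by (auto simp: L_def)
  have "\<P>(w in M. \<bar>Z m w\<bar> > L) < e" for m
  proof -
    have "\<P>(w in M. \<bar>Z m w\<bar> > L) \<le> \<P>(w in M. L\<^sup>2 \<le> (Z m w)\<^sup>2)"
      using L(1) by (intro finite_measure_mono subsetI) (auto intro: abs_le_square_iff[THEN iffD1])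
    also have "\<dots> \<le> expectation (\<lambda>w. (Z m w)\<^sup>2) / L\<^sup>2"
      by (rule integral_Markov_inequality_measure[OF int, of "{}"]) (use L(1) in auto)
    also have "\<dots> \<le> K / L\<^sup>2" by (intro divide_right_mono le) auto
    also have "\<dots> < e" using K e unfolding L(2) by (simp add: field_simps)
    finally show ?thesis .
  qed
  then show "\<exists>K>0. \<forall>\<^sub>F m in sequentially. \<P>(w in M. \<bar>Z m w\<bar> > K) < e" using L(1) by auto
qed

text \<open>Replaces a random denominator by its limit. Where \<open>D\<close> is nonzero,
  \<open>V - L / d\<close> splits into \<open>(1 / D - 1 / d) * L\<close>, a null sequence times a
  bounded one, and \<open>(N - L) / D\<close>, a null sequence times a convergent one.\<close>

lemma converges_in_prob_ratio:
  assumes [measurable]: "\<And>m. V m \<in> borel_measurable M" "\<And>m. N m \<in> borel_measurable M"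
      "\<And>m. L m \<in> borel_measurable M" "\<And>m. D m \<in> borel_measurable M"
    and NL: "converges_in_prob M (\<lambda>m w. N m w - L m w) 0" and L: "bounded_in_prob M L"
    and D: "converges_in_prob M D d" "d \<noteq> 0"
    and eq: "\<And>m w. w \<in> space M \<Longrightarrow> D m w \<noteq> 0 \<Longrightarrow> V m w * D m w = N m w"
  shows "converges_in_prob M (\<lambda>m w. V m w - L m w / d) 0"
proof (rule converges_in_prob_cong_nonzero[where D = D and d = d])
  have inv: "converges_in_prob M (\<lambda>m w. inverse (D m w)) (inverse d)"
    using D(2) by (intro converges_in_prob_isCont[OF assms(4) D(1), of inverse] continuous_at_within_inverse
        continuous_ident) simp_all
  have const: "converges_in_prob M (\<lambda>m w. inverse d) (inverse d)"
    by (auto simp: converges_in_prob_def)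
  have "converges_in_prob M (\<lambda>m w. inverse (D m w) - inverse d) 0"
    using converges_in_prob_diff[OF _ _ inv const] by simp
  then have "converges_in_prob M (\<lambda>m w. (inverse (D m w) - inverse d) * L m w) 0"
    by (intro converges_in_prob_mult_bounded L) auto
  moreover have "converges_in_prob M (\<lambda>m w. (N m w - L m w) * inverse (D m w)) (0 * inverse d)"
    by (intro converges_in_prob_mult NL inv) auto
  ultimately show "converges_in_prob M
      (\<lambda>m w. (inverse (D m w) - inverse d) * L m w + (N m w - L m w) * inverse (D m w)) 0"
    using converges_in_prob_add[of "\<lambda>m w. (inverse (D m w) - inverse d) * L m w"
        "\<lambda>m w. (N m w - L m w) * inverse (D m w)" 0 "0 * inverse d"] by simp
  fix m w assume "w \<in> space M" "D m w \<noteq> 0"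
  from eq[OF this] this(2) have V: "V m w = N m w / D m w" by (simp add: nonzero_eq_divide_eq)
  show "V m w - L m w / d =
      (inverse (D m w) - inverse d) * L m w + (N m w - L m w) * inverse (D m w)"
    unfolding V by (simp add: divide_inverse algebra_simps)
qed (use D in measurable)

text \<open>On the level of characteristic functions, \<open>exp (i t W)\<close> and
  \<open>exp (i t Z)\<close> differ by at most the minimum of
  \<open>\<bar>t\<bar> * \<bar>W - Z\<bar>\<close> and 2. Splitting at
  \<open>\<bar>W - Z\<bar> > e\<close> bounds the difference of the characteristic functions by
  \<open>\<bar>t\<bar> * e\<close> plus twice the probability of that event, and Levy's continuity
  theorem concludes.\<close>

lemma weak_conv_m_slutsky:
  assumes [measurable]: "\<And>m. Z m \<in> borel_measurable M" "\<And>m. W m \<in> borel_measurable M"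
    and lim: "weak_conv_m (\<lambda>m. distr M borel (Z m)) \<mu>" and \<mu>: "real_distribution \<mu>"
    and WZ: "converges_in_prob M (\<lambda>m w. W m w - Z m w) 0"
  shows "weak_conv_m (\<lambda>m. distr M borel (W m)) \<mu>"
proof (rule levy_continuity)
  have rd: "real_distribution (distr M borel (Z m))" "real_distribution (distr M borel (W m))" for m
    by (auto intro!: real_distribution_distr)
  show "real_distribution (distr M borel (W m))" for m by (rule rd)
  fix t :: real
  let ?p = "\<lambda>e m. \<P>(w in M. \<bar>W m w - Z m w - 0\<bar> > e)"
  have bound: "cmod (char (distr M borel (W m)) t - char (distr M borel (Z m)) t)
      \<le> \<bar>t\<bar> * e + 2 * ?p e m" if e: "e > 0" for e m
  proof -
    have int: "integrable M (\<lambda>w. iexp (t * g w))" if [measurable]: "g \<in> borel_measurable M" for g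
      by (rule integrable_const_bound[of _ 1]) auto
    have i2: "integrable M (\<lambda>w. \<bar>t\<bar> * e + 2 * indicator {w \<in> space M. \<bar>W m w - Z m w - 0\<bar> > e} w)"
      by (intro Bochner_Integration.integrable_add integrable_mult_right) (auto simp: emeasure_eq_measure)
    have "char (distr M borel (W m)) t - char (distr M borel (Z m)) t
        = (CLINT w|M. iexp (t * W m w) - iexp (t * Z m w))"
      unfolding char_def using int[of "W m"] int[of "Z m"] by (simp add: integral_distr)
    also have "cmod \<dots> \<le> (LINT w|M. cmod (iexp (t * W m w) - iexp (t * Z m w)))"
      by (rule integral_norm_bound)
    also have "\<dots> \<le> (LINT w|M. \<bar>t\<bar> * e + 2 * indicator {w \<in> space M. \<bar>W m w - Z m w - 0\<bar> > e} w)"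
    proof (rule integral_mono[OF _ i2])
      show "integrable M (\<lambda>w. cmod (iexp (t * W m w) - iexp (t * Z m w)))"
        by (intro integrable_norm Bochner_Integration.integrable_diff int) auto
      fix w assume w: "w \<in> space M"
      have "iexp (t * W m w) - iexp (t * Z m w) = iexp (t * Z m w) * (iexp (t * (W m w - Z m w)) - 1)"
        by (simp add: algebra_simps flip: exp_add)
      then have *: "cmod (iexp (t * W m w) - iexp (t * Z m w)) = cmod (iexp (t * (W m w - Z m w)) - 1)"
        by (simp add: norm_mult)
      have 1: "cmod (iexp (t * (W m w - Z m w)) - 1) \<le> \<bar>t\<bar> * \<bar>W m w - Z m w\<bar>"
        using iexp_approx1[of "t * (W m w - Z m w)" 0] by (simp add: abs_mult)
      have 2: "cmod (iexp (t * (W m w - Z m w)) - 1) \<le> 2"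
        using norm_triangle_ineq4[of "iexp (t * (W m w - Z m w))" 1] by simp
      show "cmod (iexp (t * W m w) - iexp (t * Z m w))
          \<le> \<bar>t\<bar> * e + 2 * indicator {w \<in> space M. \<bar>W m w - Z m w - 0\<bar> > e} w"
      proof (cases "\<bar>W m w - Z m w\<bar> > e")
        case True
        have "0 \<le> \<bar>t\<bar> * e" using e by simp
        then have "cmod (iexp (t * (W m w - Z m w)) - 1) \<le> \<bar>t\<bar> * e + 2" using 2 by linarith
        then show ?thesis using True w unfolding * by simp
      next
        case False
        then have "\<bar>t\<bar> * \<bar>W m w - Z m w\<bar> \<le> \<bar>t\<bar> * e" by (intro mult_left_mono) auto
        then show ?thesis using 1 False unfolding * by simp
      qed
    qed
    also have "\<dots> = \<bar>t\<bar> * e + 2 * ?p e m"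
      using i2 by (subst Bochner_Integration.integral_add) (auto simp: prob_space emeasure_eq_measure)
    finally show ?thesis .
  qed
  have "(\<lambda>m. char (distr M borel (W m)) t - char (distr M borel (Z m)) t) \<longlonglongrightarrow> 0"
  proof (rule tendstoI)
    fix d :: real assume d: "d > 0"
    \<comment> \<open>The summand 1 covers \<open>t = 0\<close> and makes
      \<open>\<bar>t\<bar> * e < d / 2\<close> strict; the other half of \<open>d\<close> is
      reserved for twice a probability below \<open>d / 4\<close>.\<close>
    define e where "e = d / (2 * (\<bar>t\<bar> + 1))"
    have e: "e > 0" using d by (simp add: e_def add_nonneg_pos)
    have "\<bar>t\<bar> * e < (\<bar>t\<bar> + 1) * e" using e by (intro mult_strict_right_mono) auto
    also have "\<dots> = d / 2" unfolding e_def by (simp add: divide_simps add_nonneg_eq_0_iff)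
    finally have te: "\<bar>t\<bar> * e < d / 2" .
    have "\<forall>\<^sub>F m in sequentially. ?p e m < d / 4"
      using d by (intro order_tendstoD(2)[OF converges_in_probD[OF WZ e]]) auto
    then show "\<forall>\<^sub>F m in sequentially.
        dist (char (distr M borel (W m)) t - char (distr M borel (Z m)) t) 0 < d"
    proof eventually_elim
      case (elim m)
      then have "cmod (char (distr M borel (W m)) t - char (distr M borel (Z m)) t) < d"
        using bound[OF e, of m] te by linarith
      then show ?case by (simp add: dist_norm)
    qed
  qed
  from tendsto_add[OF this levy_continuity1[OF rd(1) \<mu> lim, of t]]
  show "(\<lambda>m. char (distr M borel (W m)) t) \<longlonglongrightarrow> char \<mu> t" by simp
qed (rule \<mu>)

end

section \<open>Second moments of sums over independent samples\<close>

lemma (in pair_sigma_finite) integrable_mult_pair: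
  fixes u :: "'a \<Rightarrow> real" and v :: "'b \<Rightarrow> real"
  assumes u: "integrable M1 u" and v: "integrable M2 v"
  shows "integrable (M1 \<Otimes>\<^sub>M M2) (\<lambda>(x, y). u x * v y)"
proof (rule Fubini_integrable)
  have [measurable]: "u \<in> borel_measurable M1" "v \<in> borel_measurable M2" using u v by auto
  show "(\<lambda>(x, y). u x * v y) \<in> borel_measurable (M1 \<Otimes>\<^sub>M M2)" by measurable
  have "integrable M1 (\<lambda>x. \<bar>u x\<bar> * (\<integral>y. \<bar>v y\<bar> \<partial>M2))" using u by auto
  then show "integrable M1 (\<lambda>x. \<integral>y. norm (case (x, y) of (x, y) \<Rightarrow> u x * v y) \<partial>M2)"
    by (simp add: abs_mult)
  show "AE x in M1. integrable M2 (\<lambda>y. case (x, y) of (x, y) \<Rightarrow> u x * v y)"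
    using v by simp
qed

lemma integrable_mult_of_squares:
  fixes f g :: "'a \<Rightarrow> real"
  assumes [measurable]: "f \<in> borel_measurable M" "g \<in> borel_measurable M"
    and "integrable M (\<lambda>x. (f x)\<^sup>2)" "integrable M (\<lambda>x. (g x)\<^sup>2)"
  shows "integrable M (\<lambda>x. f x * g x)"
proof (rule Bochner_Integration.integrable_bound)
  show "integrable M (\<lambda>x. (f x)\<^sup>2 + (g x)\<^sup>2)" using assms by auto
  have "\<bar>f x\<bar> * \<bar>g x\<bar> \<le> (f x)\<^sup>2 + (g x)\<^sup>2" for x
  proof -
    have "2 * (\<bar>f x\<bar> * \<bar>g x\<bar>) \<le> (f x)\<^sup>2 + (g x)\<^sup>2"
      using zero_le_power2[of "\<bar>f x\<bar> - \<bar>g x\<bar>"] by (simp add: power2_diff)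
    moreover have "0 \<le> \<bar>f x\<bar> * \<bar>g x\<bar>" by simp
    ultimately show ?thesis by linarith
  qed
  then show "AE x in M. norm (f x * g x) \<le> norm ((f x)\<^sup>2 + (g x)\<^sup>2)"
    by (auto simp: abs_mult)
qed measurable

lemma integrable_square_add:
  fixes f g :: "'a \<Rightarrow> real"
  assumes "f \<in> borel_measurable M" "g \<in> borel_measurable M"
    and "integrable M (\<lambda>x. (f x)\<^sup>2)" "integrable M (\<lambda>x. (g x)\<^sup>2)"
  shows "integrable M (\<lambda>x. (f x + g x)\<^sup>2)"
  using assms integrable_mult_of_squares[OF assms]
  by (simp add: power2_sum mult.assoc)

lemma integrable_square_bounded_mult:
  fixes f g :: "'a \<Rightarrow> real"
  assumes [measurable]: "f \<in> borel_measurable M" "g \<in> borel_measurable M"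
    and f: "integrable M (\<lambda>x. (f x)\<^sup>2)" and g: "AE x in M. \<bar>g x\<bar> \<le> K"
  shows "integrable M (\<lambda>x. (g x * f x)\<^sup>2)"
proof (rule Bochner_Integration.integrable_bound)
  show "integrable M (\<lambda>x. K\<^sup>2 * (f x)\<^sup>2)" using f by simp
  show "AE x in M. norm ((g x * f x)\<^sup>2) \<le> norm (K\<^sup>2 * (f x)\<^sup>2)"
    using g
  proof eventually_elim
    case (elim x)
    then have "(g x)\<^sup>2 \<le> K\<^sup>2" using abs_le_square_iff[of "g x" K] by auto
    then show ?case by (simp add: power_mult_distrib mult_right_mono)
  qed
qed measurable

text \<open>After expanding the square, row \<open>p\<close> has at most \<open>c\<close> nonzero
  mixed moments, each at most \<open>K\<close> because
  \<open>2 * u * v \<le> u\<^sup>2 + v\<^sup>2\<close>. The neighbourhoods \<open>N p\<close> used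
  later are \<open>{p}\<close> for centred independent summands, \<open>{p, prod.swap p}\<close> for
  degenerate kernels, and all of \<open>{..<m}\<close> when there is no orthogonality to
  exploit.\<close>

lemma second_moment_sum_le:
  fixes H :: "'p \<Rightarrow> 'a \<Rightarrow> real" and K :: real
  assumes P: "finite P"
    and meas[measurable]: "\<And>p. p \<in> P \<Longrightarrow> H p \<in> borel_measurable M"
    and int: "\<And>p. p \<in> P \<Longrightarrow> integrable M (\<lambda>w. (H p w)\<^sup>2)"
    and le: "\<And>p. p \<in> P \<Longrightarrow> (\<integral>w. (H p w)\<^sup>2 \<partial>M) \<le> K"
    and orth: "\<And>p q. p \<in> P \<Longrightarrow> q \<in> P \<Longrightarrow> q \<notin> N p \<Longrightarrow> (\<integral>w. H p w * H q w \<partial>M) = 0"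
    and N: "\<And>p. finite (N p)" "\<And>p. card (N p) \<le> c"
  shows "integrable M (\<lambda>w. (\<Sum>p\<in>P. H p w)\<^sup>2)"
    and "(\<integral>w. (\<Sum>p\<in>P. H p w)\<^sup>2 \<partial>M) \<le> real (card P) * (real c * K)"
proof -
  have eq: "(\<Sum>p\<in>P. H p w)\<^sup>2 = (\<Sum>p\<in>P. \<Sum>q\<in>P. H p w * H q w)" for w
    by (simp add: power2_eq_square sum_product)
  have i: "integrable M (\<lambda>w. H p w * H q w)" if "p \<in> P" "q \<in> P" for p q
    using that by (intro integrable_mult_of_squares meas int)
  then show "integrable M (\<lambda>w. (\<Sum>p\<in>P. H p w)\<^sup>2)"
    unfolding eq by auto
  have b: "(\<integral>w. H p w * H q w \<partial>M) \<le> K" if "p \<in> P" "q \<in> P" for p q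
  proof -
    have "(\<integral>w. H p w * H q w \<partial>M) \<le> (\<integral>w. ((H p w)\<^sup>2 + (H q w)\<^sup>2) / 2 \<partial>M)"
    proof (intro integral_mono i that)
      show "integrable M (\<lambda>w. ((H p w)\<^sup>2 + (H q w)\<^sup>2) / 2)" using int that by auto
      show "H p w * H q w \<le> ((H p w)\<^sup>2 + (H q w)\<^sup>2) / 2" for w
        using zero_le_power2[of "H p w - H q w"] by (simp add: power2_diff)
    qed
    also have "\<dots> = ((\<integral>w. (H p w)\<^sup>2 \<partial>M) + (\<integral>w. (H q w)\<^sup>2 \<partial>M)) / 2"
      using int that by simp
    also have "\<dots> \<le> K" using le[of p] le[of q] that by simp
    finally show ?thesis .
  qed
  have row: "(\<Sum>q\<in>P. \<integral>w. H p w * H q w \<partial>M) \<le> real c * K" if p: "p \<in> P" for p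
  proof -
    \<comment> \<open>Nonnegativity of \<open>K\<close> becomes available only with an element of
      \<open>P\<close> at hand, so it is derived inside the row.\<close>
    have "0 \<le> (\<integral>w. (H p w)\<^sup>2 \<partial>M)" by simp
    then have K: "0 \<le> K" using le[OF p] by linarith
    have "(\<Sum>q\<in>P. \<integral>w. H p w * H q w \<partial>M) = (\<Sum>q\<in>P \<inter> N p. \<integral>w. H p w * H q w \<partial>M)"
      using P p orth by (intro sum.mono_neutral_right) auto
    also have "\<dots> \<le> (\<Sum>q\<in>P \<inter> N p. K)" using p b by (intro sum_mono) auto
    also have "\<dots> = real (card (P \<inter> N p)) * K" by simp
    also have "\<dots> \<le> real c * K"
      using order_trans[OF card_mono[OF N(1)] N(2), of "P \<inter> N p" p] K by (intro mult_right_mono) auto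
    finally show ?thesis .
  qed
  have "(\<integral>w. (\<Sum>p\<in>P. H p w)\<^sup>2 \<partial>M) = (\<Sum>p\<in>P. \<Sum>q\<in>P. \<integral>w. H p w * H q w \<partial>M)"
    unfolding eq using i by (simp add: Bochner_Integration.integral_sum)
  also have "\<dots> \<le> (\<Sum>p\<in>P. real c * K)" by (intro sum_mono row)
  finally show "(\<integral>w. (\<Sum>p\<in>P. H p w)\<^sup>2 \<partial>M) \<le> real (card P) * (real c * K)" by simp
qed

text \<open>\<open>D\<close> is both the measurable space of the observations and their common law,
  so that \<open>distr M D (Z i) = D\<close> expresses identical distribution and population
  quantities are integrals over \<open>D\<close>.\<close>

locale iid_sample = prob_space M for M :: "'a measure" +
  fixes D :: "'z measure" and Z :: "nat \<Rightarrow> 'a \<Rightarrow> 'z"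
  assumes indep: "indep_vars (\<lambda>_. D) Z UNIV"
    and distr_Z: "\<And>i. distr M D (Z i) = D"
begin

lemma Z_measurable [measurable]: "Z i \<in> measurable M D"
  using indep unfolding indep_vars_def by auto

sublocale D: prob_space D
  using prob_space_distr[OF Z_measurable[of 0]] unfolding distr_Z .

sublocale DD: pair_prob_space D D ..

lemma
  fixes g :: "'z \<Rightarrow> real"
  assumes "g \<in> borel_measurable D"
  shows expectation_Z: "expectation (\<lambda>w. g (Z i w)) = (\<integral>z. g z \<partial>D)"
    and integrable_Z: "integrable M (\<lambda>w. g (Z i w)) \<longleftrightarrow> integrable D g"
  using integral_distr[OF Z_measurable[of i], of g] integrable_distr_eq[OF Z_measurable[of i], of g] assms
  unfolding distr_Z by auto

text \<open>Plays the part of conditioning on all observations other than the \<open>i\<close>-th: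
  the joint law of \<open>Z i\<close> and the remaining family is a product, so Fubini's theorem
  integrates \<open>Z i\<close> out first while the rest is frozen at \<open>v\<close>.\<close>

lemma expectation_fresh_zero:
  fixes G :: "'z \<Rightarrow> (nat \<Rightarrow> 'z) \<Rightarrow> real"
  assumes [measurable]: "case_prod G \<in> borel_measurable (D \<Otimes>\<^sub>M PiM (-{i}) (\<lambda>_. D))"
    and int: "integrable M (\<lambda>w. G (Z i w) (restrict (\<lambda>j. Z j w) (-{i})))"
    and zero: "\<And>v. v \<in> space (PiM (-{i}) (\<lambda>_. D)) \<Longrightarrow> (\<integral>z. G z v \<partial>D) = 0"
  shows "expectation (\<lambda>w. G (Z i w) (restrict (\<lambda>j. Z j w) (-{i}))) = 0"
proof -
  let ?P = "PiM (-{i}) (\<lambda>_. D)" and ?V = "\<lambda>w. restrict (\<lambda>j. Z j w) (-{i})"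
  \<comment> \<open>The single observation is kept as a family indexed by \<open>{i}\<close>,
    because \<open>indep_var_restrict\<close> speaks of restrictions to disjoint index sets;
    \<open>G\<close> then reads it as \<open>u i\<close>.\<close>
  let ?S = "PiM {i} (\<lambda>_. D)" and ?U = "\<lambda>w. restrict (\<lambda>j. Z j w) {i}"
  have V[measurable]: "?V \<in> measurable M ?P" and U[measurable]: "?U \<in> measurable M ?S" by measurable
  have c[measurable]: "(\<lambda>u. u i) \<in> measurable ?S D" by measurable
  interpret P: prob_space "distr M ?P ?V" by (rule prob_space_distr) measurable
  interpret S: prob_space "distr M ?S ?U" by (rule prob_space_distr) measurable
  interpret SP: pair_prob_space "distr M ?S ?U" "distr M ?P ?V" ..
  let ?G = "\<lambda>u v. G (u i) v"
  have eq: "distr M ?S ?U \<Otimes>\<^sub>M distr M ?P ?V = distr M (?S \<Otimes>\<^sub>M ?P) (\<lambda>w. (?U w, ?V w))"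
    using indep_var_restrict[OF indep, of "{i}" "-{i}"] unfolding indep_var_distribution_eq by auto
  have Gm[measurable]: "case_prod ?G \<in> borel_measurable (?S \<Otimes>\<^sub>M ?P)" by measurable
  have "integrable (distr M ?S ?U \<Otimes>\<^sub>M distr M ?P ?V) (case_prod ?G)"
    unfolding eq using int by (subst integrable_distr_eq) auto
  from SP.integral_snd[OF this]
  have "integral\<^sup>L (distr M ?S ?U \<Otimes>\<^sub>M distr M ?P ?V) (case_prod ?G)
      = (\<integral>v. (\<integral>u. ?G u v \<partial>distr M ?S ?U) \<partial>distr M ?P ?V)" ..
  also have "\<dots> = (\<integral>v. 0 \<partial>distr M ?P ?V)"
  proof (rule Bochner_Integration.integral_cong)
    fix v assume "v \<in> space (distr M ?P ?V)"
    then have v[measurable]: "v \<in> space ?P" by simp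
    have m: "(\<lambda>z. G z v) \<in> borel_measurable D" by measurable
    then have "(\<integral>u. ?G u v \<partial>distr M ?S ?U) = expectation (\<lambda>w. G (Z i w) v)"
      by (subst integral_distr) auto
    also have "\<dots> = 0" using expectation_Z[OF m] zero[OF v] by simp
    finally show "(\<integral>u. ?G u v \<partial>distr M ?S ?U) = 0" .
  qed simp
  finally show ?thesis unfolding eq by (simp add: integral_distr)
qed

lemma distr_pair:
  assumes "i \<noteq> j"
  shows "distr M (D \<Otimes>\<^sub>M D) (\<lambda>w. (Z i w, Z j w)) = D \<Otimes>\<^sub>M D"
proof -
  have "indep_var D ((\<lambda>v. v i) \<circ> (\<lambda>w. restrict (\<lambda>j. Z j w) {i}))
      D ((\<lambda>v. v j) \<circ> (\<lambda>w. restrict (\<lambda>j. Z j w) {j}))"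
    by (rule indep_var_compose[OF indep_var_restrict[OF indep]]) (use assms in auto)
  then have "indep_var D (Z i) D (Z j)" by (simp add: comp_def)
  then show ?thesis unfolding indep_var_distribution_eq distr_Z by simp
qed

lemma second_moment_sum_iid:
  fixes g :: "'z \<Rightarrow> real"
  assumes [measurable]: "g \<in> borel_measurable D"
    and sq: "integrable D (\<lambda>z. (g z)\<^sup>2)" and mean: "(\<integral>z. g z \<partial>D) = 0"
  shows "integrable M (\<lambda>w. (\<Sum>i<m. g (Z i w))\<^sup>2)"
    and "expectation (\<lambda>w. (\<Sum>i<m. g (Z i w))\<^sup>2) \<le> real m * (\<integral>z. (g z)\<^sup>2 \<partial>D)"
proof -
  have orth: "expectation (\<lambda>w. g (Z i w) * g (Z j w)) = 0" if "j \<notin> {i}" for i j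
  proof -
    let ?G = "\<lambda>z v. g z * g (v j :: 'z)"
    have [measurable]: "(\<lambda>v. v j) \<in> measurable (PiM (-{i}) (\<lambda>_. D)) D" 
      using that by (intro measurable_component_singleton) auto
    have "expectation (\<lambda>w. ?G (Z i w) (restrict (\<lambda>j. Z j w) (-{i}))) = 0"
    proof (rule expectation_fresh_zero)
      show "integrable M (\<lambda>w. ?G (Z i w) (restrict (\<lambda>j. Z j w) (-{i})))"
        using that sq by (auto intro!: integrable_mult_of_squares simp: integrable_Z[of "\<lambda>z. (g z)\<^sup>2"])
    qed (simp_all add: mean)
    then show ?thesis using that by simp
  qed
  have 1: "(\<lambda>w. g (Z p w)) \<in> borel_measurable M" for p by measurable
  have 2: "integrable M (\<lambda>w. (g (Z p w))\<^sup>2)" for p using sq by (simp add: integrable_Z[of "\<lambda>z. (g z)\<^sup>2"])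
  have 3: "expectation (\<lambda>w. (g (Z p w))\<^sup>2) \<le> (\<integral>z. (g z)\<^sup>2 \<partial>D)" for p
    by (simp add: expectation_Z[of "\<lambda>z. (g z)\<^sup>2"])
  show "integrable M (\<lambda>w. (\<Sum>i<m. g (Z i w))\<^sup>2)"
    and "expectation (\<lambda>w. (\<Sum>i<m. g (Z i w))\<^sup>2) \<le> real m * (\<integral>z. (g z)\<^sup>2 \<partial>D)"
    using second_moment_sum_le[of "{..<m}" "\<lambda>i w. g (Z i w)" M "\<integral>z. (g z)\<^sup>2 \<partial>D" "\<lambda>p. {p}" 1,
        OF _ 1 2 3 orth]
    by auto
qed

text \<open>Degeneracy means that integrating out either argument gives zero. Hence the mixed moment
  for (i, j) and (k, l) vanishes unless both \<open>i\<close> and \<open>j\<close> occur among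
  \<open>k\<close> and \<open>l\<close>, which leaves only (i, j) itself and its swap. Of the order
  of \<open>m^4\<close> mixed moments at most of the order of \<open>m\<^sup>2\<close> survive.
  Diagonal pairs are excluded, since degeneracy says nothing about \<open>H z z\<close>.\<close>

lemma second_moment_degenerate:
  fixes H :: "'z \<Rightarrow> 'z \<Rightarrow> real"
  assumes [measurable]: "case_prod H \<in> borel_measurable (D \<Otimes>\<^sub>M D)"
    and sq: "integrable (D \<Otimes>\<^sub>M D) (\<lambda>(x, y). (H x y)\<^sup>2)"
    and left: "\<And>y. y \<in> space D \<Longrightarrow> (\<integral>x. H x y \<partial>D) = 0"
    and right: "\<And>x. x \<in> space D \<Longrightarrow> (\<integral>y. H x y \<partial>D) = 0"
  defines "P \<equiv> \<lambda>m. {(i, j). i < m \<and> j < m \<and> i \<noteq> (j::nat)}"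
  shows "integrable M (\<lambda>w. (\<Sum>(i, j)\<in>P m. H (Z i w) (Z j w))\<^sup>2)"
    and "expectation (\<lambda>w. (\<Sum>(i, j)\<in>P m. H (Z i w) (Z j w))\<^sup>2)
      \<le> (real m)\<^sup>2 * (2 * (\<integral>(x, y). (H x y)\<^sup>2 \<partial>(D \<Otimes>\<^sub>M D)))"
proof -
  let ?K = "\<integral>(x, y). (H x y)\<^sup>2 \<partial>(D \<Otimes>\<^sub>M D)"
  have meas[measurable]: "(\<lambda>w. H (Z i w) (Z j w)) \<in> borel_measurable M" for i j by measurable
  have sqm[measurable]: "(\<lambda>(x, y). (H x y)\<^sup>2) \<in> borel_measurable (D \<Otimes>\<^sub>M D)" by measurable
  have int: "integrable M (\<lambda>w. (H (Z i w) (Z j w))\<^sup>2)"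
    and mom: "expectation (\<lambda>w. (H (Z i w) (Z j w))\<^sup>2) = ?K" if "i \<noteq> j" for i j
    using sq integrable_distr_eq[of "\<lambda>w. (Z i w, Z j w)" M "D \<Otimes>\<^sub>M D" "\<lambda>(x, y). (H x y)\<^sup>2"]
      integral_distr[of "\<lambda>w. (Z i w, Z j w)" M "D \<Otimes>\<^sub>M D" "\<lambda>(x, y). (H x y)\<^sup>2"]
    unfolding distr_pair[OF that] by auto
  \<comment> \<open>An index occurring in only one of the two factors is integrated out first.\<close>
  have orth: "expectation (\<lambda>w. H (Z i w) (Z j w) * H (Z k w) (Z l w)) = 0"
    if ij: "i \<noteq> j" and kl: "k \<noteq> l" and ne: "i \<notin> {k, l} \<or> j \<notin> {k, l}" for i j k l
  proof -
    have prod: "integrable M (\<lambda>w. H (Z i w) (Z j w) * H (Z k w) (Z l w))"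
      by (intro integrable_mult_of_squares int ij kl meas)
    show ?thesis
    proof (cases "i \<in> {k, l}")
      case False
      let ?G = "\<lambda>z v. H z (v j) * H (v k) (v l)"
      have [measurable]: "(\<lambda>v. v j) \<in> measurable (PiM (-{i}) (\<lambda>_. D)) D"
          "(\<lambda>v. v k) \<in> measurable (PiM (-{i}) (\<lambda>_. D)) D"
          "(\<lambda>v. v l) \<in> measurable (PiM (-{i}) (\<lambda>_. D)) D"
        using ij False by (auto intro!: measurable_component_singleton)
      have "expectation (\<lambda>w. ?G (Z i w) (restrict (\<lambda>j. Z j w) (-{i}))) = 0"
      proof (rule expectation_fresh_zero)
        show "case_prod ?G \<in> borel_measurable (D \<Otimes>\<^sub>M PiM (-{i}) (\<lambda>_. D))" by measurable
        show "integrable M (\<lambda>w. ?G (Z i w) (restrict (\<lambda>j. Z j w) (-{i})))"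
          using prod ij False by simp
        fix v assume "v \<in> space (PiM (-{i}) (\<lambda>_. D))"
        then have "v j \<in> space D" using ij by (auto simp: space_PiM)
        then show "(\<integral>z. ?G z v \<partial>D) = 0" by (simp add: left)
      qed
      then show ?thesis using ij False by simp
    next
      case True
      with ne have j: "j \<notin> {k, l}" by blast
      let ?G = "\<lambda>z v. H (v i) z * H (v k) (v l)"
      have [measurable]: "(\<lambda>v. v i) \<in> measurable (PiM (-{j}) (\<lambda>_. D)) D"
          "(\<lambda>v. v k) \<in> measurable (PiM (-{j}) (\<lambda>_. D)) D"
          "(\<lambda>v. v l) \<in> measurable (PiM (-{j}) (\<lambda>_. D)) D"
        using ij j by (auto intro!: measurable_component_singleton)
      have "expectation (\<lambda>w. ?G (Z j w) (restrict (\<lambda>i. Z i w) (-{j}))) = 0"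
      proof (rule expectation_fresh_zero)
        show "case_prod ?G \<in> borel_measurable (D \<Otimes>\<^sub>M PiM (-{j}) (\<lambda>_. D))" by measurable
        show "integrable M (\<lambda>w. ?G (Z j w) (restrict (\<lambda>i. Z i w) (-{j})))"
          using prod ij j by simp
        fix v assume "v \<in> space (PiM (-{j}) (\<lambda>_. D))"
        then have "v i \<in> space D" using ij by (auto simp: space_PiM)
        then show "(\<integral>z. ?G z v \<partial>D) = 0" by (simp add: right)
      qed
      then show ?thesis using ij j by simp
    qed
  qed
  let ?H = "\<lambda>p w. H (Z (fst p) w) (Z (snd p) w)" and ?N = "\<lambda>p. {p, prod.swap p}"
  have sub: "P m \<subseteq> {..<m} \<times> {..<m}" by (auto simp: P_def)
  have fin: "finite (P m)" by (rule finite_subset[OF sub]) auto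
  have card: "real (card (P m)) \<le> (real m)\<^sup>2"
    using card_mono[OF _ sub] by (simp add: power2_eq_square flip: of_nat_mult)
  have o: "expectation (\<lambda>w. ?H p w * ?H q w) = 0" if "p \<in> P m" "q \<in> P m" "q \<notin> ?N p" for p q
    using that by (intro orth) (auto simp: P_def)
  have i: "integrable M (\<lambda>w. (?H p w)\<^sup>2)" "expectation (\<lambda>w. (?H p w)\<^sup>2) \<le> ?K" if "p \<in> P m" for p
    using that int mom by (auto simp: P_def)
  note * = second_moment_sum_le[of "P m" ?H M ?K ?N 2, OF fin meas i o]
  have eq: "(\<Sum>(i, j)\<in>P m. H (Z i w) (Z j w)) = (\<Sum>p\<in>P m. ?H p w)" for w
    by (simp add: case_prod_beta)
  have K: "0 \<le> ?K" by (auto intro!: integral_nonneg_AE)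
  have c: "card (?N p) \<le> 2" for p :: "nat \<times> nat" by (simp add: card_insert_if)
  show "integrable M (\<lambda>w. (\<Sum>(i, j)\<in>P m. H (Z i w) (Z j w))\<^sup>2)"
    unfolding eq by (rule *(1)) (use c in auto)
  have "expectation (\<lambda>w. (\<Sum>(i, j)\<in>P m. H (Z i w) (Z j w))\<^sup>2) \<le> real (card (P m)) * (real 2 * ?K)"
    unfolding eq by (rule *(2)) (use c in auto)
  also have "\<dots> \<le> (real m)\<^sup>2 * (2 * ?K)" using card K by (intro mult_mono) auto
  finally show "expectation (\<lambda>w. (\<Sum>(i, j)\<in>P m. H (Z i w) (Z j w))\<^sup>2) \<le> (real m)\<^sup>2 * (2 * ?K)" .
qed

end

section \<open>Hoeffding decomposition of the V-statistic\<close>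

lemma (in finite_measure) abs_integral_if_le:
  fixes b :: "'a \<Rightarrow> real"
  assumes b: "integrable M b" and P: "Measurable.pred M P"
  shows "\<bar>\<integral>y. (if P y then b y else 0) \<partial>M\<bar> \<le> (\<integral>y. \<bar>b y\<bar> \<partial>M)"
proof -
  have [measurable]: "b \<in> borel_measurable M" using b by auto
  note P[measurable]
  have "\<bar>\<integral>y. (if P y then b y else 0) \<partial>M\<bar> \<le> (\<integral>y. \<bar>if P y then b y else 0\<bar> \<partial>M)"
    by (rule integral_abs_bound)
  also have "\<dots> \<le> (\<integral>y. \<bar>b y\<bar> \<partial>M)"
    using b by (intro integral_mono_AE Bochner_Integration.integrable_bound[OF b]) (auto intro!: AE_I2)
  finally show ?thesis .
qed

context iid_sample
begin

text \<open>The functions \<open>a x * \<beta> (r x)\<close> and \<open>b y * \<alpha> (r y)\<close>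
  are the projections of the kernel onto its first and second argument, and \<open>\<mu>\<close> is
  its mean. Since \<open>\<beta>\<close> and \<open>\<alpha>\<close> are bounded by the L1 norms of
  \<open>b\<close> and \<open>a\<close>, square integrability of \<open>a\<close> and
  \<open>b\<close> passes to the projections and to the remainder.\<close>

lemma ustat_linearization:
  fixes a b r :: "'z \<Rightarrow> real"
  assumes [measurable]: "a \<in> borel_measurable D" "b \<in> borel_measurable D" "r \<in> borel_measurable D"
    and a: "integrable D (\<lambda>z. (a z)\<^sup>2)" and b: "integrable D (\<lambda>z. (b z)\<^sup>2)"
  defines "\<beta> \<equiv> \<lambda>s. \<integral>y. (if r y < s then b y else 0) \<partial>D"
    and "\<alpha> \<equiv> \<lambda>s. \<integral>x. (if s < r x then a x else 0) \<partial>D"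
  defines "\<mu> \<equiv> \<integral>x. a x * \<beta> (r x) \<partial>D"
  shows "(\<integral>y. b y * \<alpha> (r y) \<partial>D) = \<mu>"
    and "integrable D (\<lambda>x. (a x * \<beta> (r x))\<^sup>2)" "integrable D (\<lambda>x. (b x * \<alpha> (r x))\<^sup>2)"
    and "converges_in_prob M (\<lambda>m w.
      sqrt (real m) * ((\<Sum>i<m. \<Sum>j<m. if r (Z j w) < r (Z i w) then a (Z i w) * b (Z j w) else 0) / (real m)\<^sup>2 - \<mu>)
      - (\<Sum>i<m. a (Z i w) * \<beta> (r (Z i w)) + b (Z i w) * \<alpha> (r (Z i w)) - 2 * \<mu>) / sqrt (real m)) 0"
proof -
  have ia: "integrable D a" by (rule D.square_integrable_imp_integrable[OF _ a]) simp
  have ib: "integrable D b" by (rule D.square_integrable_imp_integrable[OF _ b]) simp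
  have m\<beta>[measurable]: "\<beta> \<in> borel_measurable borel" and m\<alpha>[measurable]: "\<alpha> \<in> borel_measurable borel"
    unfolding \<beta>_def \<alpha>_def by measurable
  define A where "A = (\<integral>z. \<bar>a z\<bar> \<partial>D)"
  define B where "B = (\<integral>z. \<bar>b z\<bar> \<partial>D)"
  have AB: "0 \<le> A" "0 \<le> B" by (auto simp: A_def B_def)
  have \<beta>: "\<bar>\<beta> s\<bar> \<le> B" and \<alpha>: "\<bar>\<alpha> s\<bar> \<le> A" for s
    unfolding \<beta>_def \<alpha>_def A_def B_def by (auto intro!: D.abs_integral_if_le ia ib)
  show sq\<beta>: "integrable D (\<lambda>x. (a x * \<beta> (r x))\<^sup>2)"
    using integrable_square_bounded_mult[OF _ _ a, of "\<lambda>x. \<beta> (r x)" B] \<beta> by (simp add: mult.commute)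
  show sq\<alpha>: "integrable D (\<lambda>x. (b x * \<alpha> (r x))\<^sup>2)"
    using integrable_square_bounded_mult[OF _ _ b, of "\<lambda>x. \<alpha> (r x)" A] \<alpha> by (simp add: mult.commute)
  have i\<beta>: "integrable D (\<lambda>x. a x * \<beta> (r x))"
    by (rule D.square_integrable_imp_integrable[OF _ sq\<beta>]) simp
  have i\<alpha>: "integrable D (\<lambda>x. b x * \<alpha> (r x))"
    by (rule D.square_integrable_imp_integrable[OF _ sq\<alpha>]) simp
  define h where "h x y = (if r y < r x then a x * b y else 0)" for x y
  have hm[measurable]: "case_prod h \<in> borel_measurable (D \<Otimes>\<^sub>M D)"
    unfolding h_def by measurable
  have int_h: "integrable (D \<Otimes>\<^sub>M D) (case_prod h)"
    by (rule Bochner_Integration.integrable_bound[OF DD.integrable_mult_pair[OF ia ib]])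
      (auto simp: h_def)
  have hy: "(\<integral>y. h x y \<partial>D) = a x * \<beta> (r x)" and hx: "(\<integral>x. h x y \<partial>D) = b y * \<alpha> (r y)" for x y
    unfolding h_def \<beta>_def \<alpha>_def
    by (auto simp flip: integral_mult_right_zero intro!: Bochner_Integration.integral_cong)
  show \<mu>: "(\<integral>y. b y * \<alpha> (r y) \<partial>D) = \<mu>"
    using DD.integral_snd[OF int_h] DD.integral_fst[OF int_h] unfolding hx hy \<mu>_def by simp
  have "\<bar>\<mu>\<bar> \<le> (\<integral>x. \<bar>a x * \<beta> (r x)\<bar> \<partial>D)" unfolding \<mu>_def by (rule integral_abs_bound)
  also have "\<dots> \<le> (\<integral>x. \<bar>a x\<bar> * B \<partial>D)"
  proof (rule integral_mono)
    show "\<bar>a x * \<beta> (r x)\<bar> \<le> \<bar>a x\<bar> * B" for x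
      using \<beta>[of "r x"] by (simp add: abs_mult mult_left_mono)
  qed (use ia i\<beta> in auto)
  also have "\<dots> = A * B" by (simp add: A_def)
  finally have \<mu>le: "\<bar>\<mu>\<bar> \<le> A * B" .
  \<comment> \<open>Subtracting both projections removes the mean twice; adding \<open>\<mu>\<close>
    back makes both marginal integrals of \<open>H\<close> zero.\<close>
  define H where "H x y = h x y - a x * \<beta> (r x) - b y * \<alpha> (r y) + \<mu>" for x y
  have Hm[measurable]: "case_prod H \<in> borel_measurable (D \<Otimes>\<^sub>M D)"
    unfolding H_def by measurable
  \<comment> \<open>The four terms of \<open>H\<close> are dominated by the four terms of a product
    of a function of \<open>x\<close> and a function of \<open>y\<close>, whose square is integrable
    under the product law.\<close>
  have H_le: "\<bar>H x y\<bar> \<le> (\<bar>a x\<bar> + A) * (\<bar>b y\<bar> + B)" for x y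
  proof -
    have "\<bar>h x y\<bar> \<le> \<bar>a x\<bar> * \<bar>b y\<bar>" by (simp add: h_def abs_mult)
    moreover have "\<bar>a x * \<beta> (r x)\<bar> \<le> \<bar>a x\<bar> * B" "\<bar>b y * \<alpha> (r y)\<bar> \<le> A * \<bar>b y\<bar>"
      using \<beta> \<alpha> by (simp_all add: abs_mult mult_left_mono mult.commute[of "\<bar>b y\<bar>"] mult_right_mono)
    moreover have "\<bar>H x y\<bar> \<le> \<bar>h x y\<bar> + \<bar>a x * \<beta> (r x)\<bar> + \<bar>b y * \<alpha> (r y)\<bar> + \<bar>\<mu>\<bar>"
      unfolding H_def by linarith
    ultimately have "\<bar>H x y\<bar> \<le> \<bar>a x\<bar> * \<bar>b y\<bar> + \<bar>a x\<bar> * B + A * \<bar>b y\<bar> + A * B"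
      using \<mu>le by linarith
    then show ?thesis by (simp add: distrib_left distrib_right)
  qed
  have sqH: "integrable (D \<Otimes>\<^sub>M D) (\<lambda>(x, y). (H x y)\<^sup>2)"
  proof (rule Bochner_Integration.integrable_bound)
    have sq: "integrable D (\<lambda>z. (\<bar>a z\<bar> + A)\<^sup>2)" "integrable D (\<lambda>z. (\<bar>b z\<bar> + B)\<^sup>2)"
      using a b by (auto intro!: integrable_square_add)
    show "integrable (D \<Otimes>\<^sub>M D) (\<lambda>(x, y). (\<bar>a x\<bar> + A)\<^sup>2 * (\<bar>b y\<bar> + B)\<^sup>2)"
      by (rule DD.integrable_mult_pair[OF sq])
    have "(H x y)\<^sup>2 \<le> (\<bar>a x\<bar> + A)\<^sup>2 * (\<bar>b y\<bar> + B)\<^sup>2" for x y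
      using power_mono[OF H_le[of x y], of 2] by (simp add: power_mult_distrib)
    then show "AE p in D \<Otimes>\<^sub>M D. norm (case p of (x, y) \<Rightarrow> (H x y)\<^sup>2)
        \<le> norm (case p of (x, y) \<Rightarrow> (\<bar>a x\<bar> + A)\<^sup>2 * (\<bar>b y\<bar> + B)\<^sup>2)"
      by auto
  qed measurable
  have ihy: "integrable D (\<lambda>y. h x y)" if x: "x \<in> space D" for x
  proof (rule Bochner_Integration.integrable_bound)
    show "integrable D (\<lambda>y. a x * b y)" using ib by simp
    show "h x \<in> borel_measurable D" unfolding h_def using x by measurable
  qed (auto simp: h_def)
  have ihx: "integrable D (\<lambda>x. h x y)" if y: "y \<in> space D" for y
  proof (rule Bochner_Integration.integrable_bound)
    show "integrable D (\<lambda>x. a x * b y)" using ia by simp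
    show "(\<lambda>x. h x y) \<in> borel_measurable D" unfolding h_def using y by measurable
  qed (auto simp: h_def)
  have left: "(\<integral>x. H x y \<partial>D) = 0" if "y \<in> space D" for y
    unfolding H_def using ihx[OF that] i\<beta>
    by (simp add: hx D.prob_space \<mu>_def)
  have right: "(\<integral>y. H x y \<partial>D) = 0" if "x \<in> space D" for x
    unfolding H_def using ihy[OF that] i\<alpha>
    by (simp add: hy \<mu> D.prob_space)
  \<comment> \<open>The diagonal of \<open>H\<close>: the kernel vanishes there because its
    inequality is strict. The integral of \<open>d\<close> is \<open>- \<mu>\<close>, so its sum is
    not centred; the crude bound of order \<open>m\<^sup>2\<close> for the second moment already
    matches that of the off-diagonal part.\<close>
  define d where "d z = \<mu> - (a z * \<beta> (r z) + b z * \<alpha> (r z))" for z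
  have dm[measurable]: "d \<in> borel_measurable D" unfolding d_def by measurable
  have Hd: "H z z = d z" for z by (simp add: H_def h_def d_def)
  have sqd: "integrable D (\<lambda>z. (d z)\<^sup>2)"
  proof -
    have "integrable D (\<lambda>z. (a z * \<beta> (r z) + b z * \<alpha> (r z))\<^sup>2)"
      by (rule integrable_square_add[OF _ _ sq\<beta> sq\<alpha>]) measurable
    then have "integrable D (\<lambda>z. (- \<mu> + (a z * \<beta> (r z) + b z * \<alpha> (r z)))\<^sup>2)"
      using sq\<beta> sq\<alpha> by (intro integrable_square_add) auto
    then show ?thesis by (simp add: d_def power2_commute add.commute)
  qed
  define P where "P m = {(i, j). i < m \<and> j < m \<and> i \<noteq> (j::nat)}" for m
  define S1 where "S1 m w = (\<Sum>(i, j)\<in>P m. H (Z i w) (Z j w))" for m w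
  define S2 where "S2 m w = (\<Sum>i<m. d (Z i w))" for m w
  define U where "U m w = (\<Sum>i<m. \<Sum>j<m. h (Z i w) (Z j w))" for m w
  have mom1: "integrable M (\<lambda>w. (S1 m w)\<^sup>2)"
      "expectation (\<lambda>w. (S1 m w)\<^sup>2) \<le> (real m)\<^sup>2 * (2 * (\<integral>(x, y). (H x y)\<^sup>2 \<partial>(D \<Otimes>\<^sub>M D)))" for m
    unfolding S1_def P_def by (rule second_moment_degenerate[OF Hm sqH left right]; simp)+
  have mom2: "integrable M (\<lambda>w. (S2 m w)\<^sup>2)"
      "expectation (\<lambda>w. (S2 m w)\<^sup>2) \<le> real (card {..<m}) * (real m * (\<integral>z. (d z)\<^sup>2 \<partial>D))" for m
    unfolding S2_def
    by (rule second_moment_sum_le[where N = "\<lambda>_. {..<m}"];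
        use sqd in \<open>auto simp: integrable_Z[of "\<lambda>z. (d z)\<^sup>2"] expectation_Z[of "\<lambda>z. (d z)\<^sup>2"]\<close>)+
  have [measurable]: "S1 m \<in> borel_measurable M" "S2 m \<in> borel_measurable M" for m
    unfolding S1_def[abs_def] S2_def[abs_def] case_prod_beta by measurable
  \<comment> \<open>In the double sum over all pairs, diagonal included, each projection term is
    repeated \<open>m\<close> times and the constant \<open>m\<^sup>2\<close> times.\<close>
  have total: "S1 m w + S2 m w = U m w - real m * (\<Sum>i<m. a (Z i w) * \<beta> (r (Z i w)) + b (Z i w) * \<alpha> (r (Z i w)))
      + (real m)\<^sup>2 * \<mu>" for m w
  proof -
    let ?F = "\<lambda>(i, j). H (Z i w) (Z j w)" and ?d = "(\<lambda>i. (i, i)) ` {..<m}"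
    have un: "P m \<union> ?d = {..<m} \<times> {..<m}" by (auto simp: P_def)
    have "finite (P m)"
      by (rule finite_subset[of _ "{..<m} \<times> {..<m}"]) (auto simp: P_def)
    then have "sum ?F (P m \<union> ?d) = sum ?F (P m) + sum ?F ?d"
      by (intro sum.union_disjoint) (auto simp: P_def)
    moreover have "S2 m w = sum ?F ?d"
      by (subst sum.reindex) (auto simp: inj_on_def S2_def Hd)
    ultimately have "S1 m w + S2 m w = sum ?F ({..<m} \<times> {..<m})"
      unfolding S1_def un by simp
    also have "\<dots> = (\<Sum>i<m. \<Sum>j<m. H (Z i w) (Z j w))"
      by (simp add: sum.cartesian_product)
    finally show ?thesis
      unfolding H_def U_def
      by (simp add: sum.distrib sum_subtractf power2_eq_square algebra_simps sum_distrib_left)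
  qed
  define C where "C = 2 * (2 * (\<integral>(x, y). (H x y)\<^sup>2 \<partial>(D \<Otimes>\<^sub>M D))) + 2 * (\<integral>z. (d z)\<^sup>2 \<partial>D)"
  have bnd: "expectation (\<lambda>w. (S1 m w + S2 m w)\<^sup>2) \<le> (real m)\<^sup>2 * C" for m
  proof -
    have "expectation (\<lambda>w. (S1 m w + S2 m w)\<^sup>2) \<le> expectation (\<lambda>w. 2 * (S1 m w)\<^sup>2 + 2 * (S2 m w)\<^sup>2)"
    proof (rule integral_mono)
      show "integrable M (\<lambda>w. (S1 m w + S2 m w)\<^sup>2)"
        by (intro integrable_square_add mom1 mom2) measurable
      show "integrable M (\<lambda>w. 2 * (S1 m w)\<^sup>2 + 2 * (S2 m w)\<^sup>2)" using mom1 mom2 by auto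
      show "(S1 m w + S2 m w)\<^sup>2 \<le> 2 * (S1 m w)\<^sup>2 + 2 * (S2 m w)\<^sup>2" for w
        using zero_le_power2[of "S1 m w - S2 m w"] by (simp add: power2_sum power2_diff)
    qed
    also have "\<dots> = 2 * expectation (\<lambda>w. (S1 m w)\<^sup>2) + 2 * expectation (\<lambda>w. (S2 m w)\<^sup>2)"
      using mom1(1) mom2(1) by simp
    also have "\<dots> \<le> (real m)\<^sup>2 * C"
      using mom1(2)[of m] mom2(2)[of m] by (simp add: C_def power2_eq_square algebra_simps)
    finally show ?thesis .
  qed
  let ?E = "\<lambda>m w. sqrt (real m) * (U m w / (real m)\<^sup>2 - \<mu>)
      - (\<Sum>i<m. a (Z i w) * \<beta> (r (Z i w)) + b (Z i w) * \<alpha> (r (Z i w)) - 2 * \<mu>) / sqrt (real m)"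
  have E: "?E m w = sqrt (real m) / (real m)\<^sup>2 * (S1 m w + S2 m w)" for m w
  proof (cases "m = 0")
    case False
    then have s: "sqrt (real m) * sqrt (real m) = real m" "sqrt (real m) \<noteq> 0" by auto
    have "1 / sqrt (real m) = sqrt (real m) / real m"
      using s False by (simp add: field_simps)
    then have i: "x / sqrt (real m) = sqrt (real m) / real m * x" for x
      by (metis divide_inverse mult.commute mult_1)
    show ?thesis using False unfolding total i
      by (simp add: sum_subtractf field_simps power2_eq_square)
  qed simp
  have "converges_in_prob M ?E 0"
    unfolding E
  \<comment> \<open>The prefactor is \<open>m\<close> to the power -3/2 and the second moment of
    \<open>S1 + S2\<close> is at most \<open>m\<^sup>2 * C\<close>, which leaves
    \<open>C / m\<close>. For \<open>m = 0\<close> all quotients are 0.\<close>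
  proof (rule converges_in_prob_of_second_moment[where u = "\<lambda>m. C / real m"])
    have sq: "(sqrt (real m) / (real m)\<^sup>2 * (S1 m w + S2 m w) - 0)\<^sup>2
        = real m / (real m)^4 * (S1 m w + S2 m w)\<^sup>2" for m w
      by (simp add: power_mult_distrib power_divide flip: power_mult)
    fix m
    show "integrable M (\<lambda>w. (sqrt (real m) / (real m)\<^sup>2 * (S1 m w + S2 m w) - 0)\<^sup>2)"
      unfolding sq by (intro integrable_mult_right integrable_square_add mom1 mom2) measurable
    have "expectation (\<lambda>w. (sqrt (real m) / (real m)\<^sup>2 * (S1 m w + S2 m w) - 0)\<^sup>2)
        = real m / (real m)^4 * expectation (\<lambda>w. (S1 m w + S2 m w)\<^sup>2)"
      unfolding sq by simp
    also have "\<dots> \<le> real m / (real m)^4 * ((real m)\<^sup>2 * C)"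
      by (intro mult_left_mono bnd) auto
    also have "\<dots> = C / real m"
      by (cases "m = 0") (simp_all add: field_simps power2_eq_square power4_eq_xxxx)
    finally show "expectation (\<lambda>w. (sqrt (real m) / (real m)\<^sup>2 * (S1 m w + S2 m w) - 0)\<^sup>2) \<le> C / real m" .
  next
    show "(\<lambda>m. C / real m) \<longlonglongrightarrow> 0" by (rule lim_const_over_n)
  qed measurable
  then show "converges_in_prob M (\<lambda>m w.
      sqrt (real m) * ((\<Sum>i<m. \<Sum>j<m. if r (Z j w) < r (Z i w) then a (Z i w) * b (Z j w) else 0) / (real m)\<^sup>2 - \<mu>)
      - (\<Sum>i<m. a (Z i w) * \<beta> (r (Z i w)) + b (Z i w) * \<alpha> (r (Z i w)) - 2 * \<mu>) / sqrt (real m)) 0"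
    unfolding U_def h_def .
qed

end

section \<open>Stieltjes integrals against weighted distribution functions\<close>

text \<open>A finite Borel measure on the line is determined by its distribution function. This lets
  distribution functions act as the monotone parts in \<open>has_stieltjes_integral\<close>, with
  known associated measures.\<close>

lemma interval_measure_cdf:
  assumes "finite_borel_measure \<mu>"
  shows "interval_measure (cdf \<mu>) = \<mu>"
proof -
  interpret finite_borel_measure \<mu> by fact
  show ?thesis
  proof (rule cdf_unique'[OF _ assms])
    show "finite_borel_measure (interval_measure (cdf \<mu>))"
      by (rule finite_borel_measure_interval_measure[OF _ _ cdf_lim_at_bot cdf_lim_at_top])
        (auto intro: cdf_nondecreasing cdf_is_right_cont)
    show "cdf (interval_measure (cdf \<mu>)) = cdf \<mu>"
      by (rule cdf_interval_measure) (auto intro: cdf_nondecreasing cdf_is_right_cont cdf_lim_at_bot)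
  qed
qed

lemma has_stieltjes_integral_cdf_diff:
  assumes "finite_borel_measure \<mu>" "finite_borel_measure \<nu>" "integrable \<mu> g" "integrable \<nu> g"
  shows "has_stieltjes_integral g (\<lambda>a. cdf \<mu> a - cdf \<nu> a) ((\<integral>x. g x \<partial>\<mu>) - (\<integral>x. g x \<partial>\<nu>))"
proof -
  interpret m: finite_borel_measure \<mu> by fact
  interpret n: finite_borel_measure \<nu> by fact
  show ?thesis
    unfolding has_stieltjes_integral_def
    by (rule exI[of _ "cdf \<mu>"], rule exI[of _ "cdf \<nu>"])
      (use assms in \<open>auto simp: mono_def interval_measure_cdf
        intro: m.cdf_nondecreasing n.cdf_nondecreasing m.cdf_is_right_cont n.cdf_is_right_cont\<close>)
qed

text \<open>A signed change of variables: the normalised weight \<open>T\<close> is a signed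
  density, its positive and negative parts are pushed forward along \<open>R\<close> to finite
  measures, and the difference of their distribution functions is the integrator.\<close>

lemma stieltjes_integral_pop_wcdf:
  assumes R[measurable]: "R \<in> borel_measurable Q" and g[measurable]: "g \<in> borel_measurable borel"
    and T: "integrable Q T" and gT: "integrable Q (\<lambda>z. g (R z) * T z)"
  shows "stieltjes_integral g (pop_wcdf Q R T) = (\<integral>z. g (R z) * T z \<partial>Q) / (\<integral>z. T z \<partial>Q)"
proof -
  define c where "c = (\<integral>z. T z \<partial>Q)"
  \<comment> \<open>\<open>S 1\<close> and \<open>S (-1)\<close> are the positive and negative part
    of \<open>T / c\<close>, whatever the sign of \<open>c\<close>. If \<open>c = 0\<close>, both
    vanish by the convention for division by zero, and so do both sides of the claim.\<close>
  define S where "S s z = max 0 (s * T z / c)" for s :: real and z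
  define m where "m s = distr (density Q (\<lambda>z. ennreal (S s z))) borel R" for s :: real
  have [measurable]: "T \<in> borel_measurable Q" using T by auto
  have [measurable]: "S s \<in> borel_measurable Q" for s unfolding S_def by measurable
  have S: "0 \<le> S s z" for s z by (simp add: S_def)
  have int: "integrable Q (\<lambda>z. u (R z) * S s z)"
    if [measurable]: "u \<in> borel_measurable borel" and "integrable Q (\<lambda>z. u (R z) * T z)"
    for s and u :: "real \<Rightarrow> real"
  proof (rule Bochner_Integration.integrable_bound)
    show "integrable Q (\<lambda>z. (u (R z) * T z) * (s / c))" using that(2) by (rule integrable_mult_left)
    show "AE z in Q. norm (u (R z) * S s z) \<le> norm (u (R z) * T z * (s / c))"
    proof (rule AE_I2)
      fix z
      have "norm (u (R z) * S s z) \<le> \<bar>u (R z)\<bar> * \<bar>s * T z / c\<bar>"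
        unfolding real_norm_def abs_mult[of "u (R z)"]
        by (rule mult_left_mono) (simp_all add: S_def abs_ge_self del: abs_divide)
      also have "\<dots> = norm (u (R z) * T z * (s / c))" by (simp add: abs_mult)
      finally show "norm (u (R z) * S s z) \<le> norm (u (R z) * T z * (s / c))" .
    qed
  qed measurable
  have m_int: "(\<integral>x. u x \<partial>m s) = (\<integral>z. u (R z) * S s z \<partial>Q)"
    and m_integrable: "integrable (m s) u \<longleftrightarrow> integrable Q (\<lambda>z. u (R z) * S s z)"
    if [measurable]: "u \<in> borel_measurable borel" for s and u :: "real \<Rightarrow> real"
    unfolding m_def
    by (simp_all add: integral_distr integrable_distr_eq integral_density integrable_density mult.commute S)
  have ind: "integrable Q (\<lambda>z. indicator A (R z) * T z)" if [measurable]: "A \<in> sets borel" for A :: "real set"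
    by (rule Bochner_Integration.integrable_bound[OF T]) (auto split: split_indicator)
  have fin: "finite_borel_measure (m s)" for s
  proof -
    have "integrable Q (\<lambda>z. S s z)"
      using int[of "\<lambda>_. 1" s] T by simp
    then have "emeasure (m s) UNIV \<noteq> \<infinity>"
      unfolding m_def
      by (simp add: emeasure_distr emeasure_density nn_integral_eq_integral S cong: nn_integral_cong_simp)
    then show ?thesis
      unfolding finite_borel_measure_def finite_borel_measure_axioms_def
      by (auto simp: m_def intro!: finite_measureI)
  qed
  have cdf: "cdf (m s) a = (\<integral>z. indicator {..a} (R z) * S s z \<partial>Q)" for s a
  proof -
    interpret finite_borel_measure "m s" by (rule fin)
    have "cdf (m s) a = (\<integral>x. indicator {..a} x \<partial>m s)"
      by (simp add: cdf_def m_def)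
    then show ?thesis using m_int[of "indicator {..a}"] by simp
  qed
  have diff: "(\<integral>z. u (R z) * S 1 z \<partial>Q) - (\<integral>z. u (R z) * S (-1) z \<partial>Q)
      = (\<integral>z. u (R z) * T z \<partial>Q) / c"
    if [measurable]: "u \<in> borel_measurable borel" and "integrable Q (\<lambda>z. u (R z) * T z)"
    for u :: "real \<Rightarrow> real"
  proof -
    have "(\<integral>z. u (R z) * S 1 z \<partial>Q) - (\<integral>z. u (R z) * S (-1) z \<partial>Q)
      = (\<integral>z. u (R z) * S 1 z - u (R z) * S (-1) z \<partial>Q)"
      by (intro Bochner_Integration.integral_diff[symmetric] int that)
    also have "\<dots> = (\<integral>z. u (R z) * T z / c \<partial>Q)"
      by (intro Bochner_Integration.integral_cong) (auto simp: S_def max_def)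
    finally show ?thesis by simp
  qed
  have F: "pop_wcdf Q R T = (\<lambda>a. cdf (m 1) a - cdf (m (-1)) a)"
  proof
    fix a show "pop_wcdf Q R T a = cdf (m 1) a - cdf (m (-1)) a"
      unfolding cdf pop_wcdf_def using diff[of "indicator {..a}"] ind[of "{..a}"]
      by (simp add: c_def)
  qed
  have "stieltjes_integral g (pop_wcdf Q R T) = (\<integral>x. g x \<partial>m 1) - (\<integral>x. g x \<partial>m (-1))"
    unfolding F
    by (intro stieltjes_integral_eqI has_stieltjes_integral_cdf_diff fin)
      (simp_all only: m_integrable[OF g] int[OF g gT])
  also have "\<dots> = (\<integral>z. g (R z) * T z \<partial>Q) / c"
    unfolding m_int[OF g] by (rule diff[OF g gT])
  finally show ?thesis by (simp add: c_def)
qed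

lemma wcdf_measurable: "wcdf m w R T \<in> borel_measurable borel"
proof -
  have "wcdf m w R T = (\<lambda>\<alpha>. (\<Sum>i<m. w i * indicator {R i..} \<alpha> * T i) / (\<Sum>i<m. w i * T i))"
    by (auto simp: wcdf_def fun_eq_iff indicator_def)
  then show ?thesis by simp
qed

text \<open>A sample is a population under the counting measure on \<open>{..<m}\<close> with
  \<open>w\<close> absorbed into the outcome, so the population formula for the Stieltjes integral
  applies.\<close>

lemma auc_hat_eq:
  "auc_hat m w R T = (\<Sum>j<m. (1 - wcdf m w R T (R j)) * (w j * (1 - T j))) / (\<Sum>j<m. w j * (1 - T j))"
proof -
  note [measurable] = wcdf_measurable
  have "wcdf m w R (\<lambda>i. 1 - T i) = pop_wcdf (count_space {..<m}) R (\<lambda>i. w i * (1 - T i))"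
    by (auto simp: wcdf_def pop_wcdf_def fun_eq_iff lebesgue_integral_count_space_finite mult_ac)
  moreover have "stieltjes_integral (\<lambda>\<alpha>. 1 - wcdf m w R T \<alpha>)
      (pop_wcdf (count_space {..<m}) R (\<lambda>i. w i * (1 - T i)))
    = (\<Sum>j<m. (1 - wcdf m w R T (R j)) * (w j * (1 - T j))) / (\<Sum>j<m. w j * (1 - T j))"
    by (subst stieltjes_integral_pop_wcdf)
      (auto simp: lebesgue_integral_count_space_finite intro!: integrable_count_space)
  ultimately show ?thesis unfolding auc_hat_def auc_def by simp
qed

text \<open>The strict comparison arises from \<open>1 - F\<close>: the distribution function counts
  ties, so its complement counts only indices with \<open>R i\<close> above \<open>R j\<close>.
  Stating the identity multiplied out gives the form consumed by
  \<open>converges_in_prob_ratio\<close>.\<close>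

lemma auc_hat_mult:
  assumes "(\<Sum>i<m. w i * T i) \<noteq> 0" "(\<Sum>j<m. w j * (1 - T j)) \<noteq> 0"
  shows "auc_hat m w R T * ((\<Sum>i<m. w i * T i) * (\<Sum>j<m. w j * (1 - T j)))
    = (\<Sum>i<m. \<Sum>j<m. if R j < R i then (w i * T i) * (w j * (1 - T j)) else 0)"
proof -
  let ?S = "\<Sum>i<m. w i * T i"
  have tail: "(1 - wcdf m w R T s) * ?S = (\<Sum>i<m. if s < R i then w i * T i else 0)" for s
  proof -
    have "(1 - wcdf m w R T s) * ?S = ?S - (\<Sum>i<m. w i * indicator {..s} (R i) * T i)"
      using assms(1) by (simp add: wcdf_def left_diff_distrib)
    also have "\<dots> = (\<Sum>i<m. if s < R i then w i * T i else 0)"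
      unfolding sum_subtractf[symmetric] by (intro sum.cong) (auto simp: indicator_def)
    finally show ?thesis .
  qed
  have "auc_hat m w R T * (?S * (\<Sum>j<m. w j * (1 - T j)))
      = (\<Sum>j<m. (1 - wcdf m w R T (R j)) * (w j * (1 - T j))) * ?S"
    using assms(2) unfolding auc_hat_eq by simp
  also have "\<dots> = (\<Sum>j<m. ((1 - wcdf m w R T (R j)) * ?S) * (w j * (1 - T j)))"
    unfolding sum_distrib_right[of _ _ ?S] by (intro sum.cong) (simp_all only: mult_ac)
  also have "\<dots> = (\<Sum>j<m. \<Sum>i<m. if R j < R i then (w i * T i) * (w j * (1 - T j)) else 0)"
    unfolding tail sum_distrib_right by (intro sum.cong) auto
  also have "\<dots> = (\<Sum>i<m. \<Sum>j<m. if R j < R i then (w i * T i) * (w j * (1 - T j)) else 0)"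
    by (rule sum.swap)
  finally show ?thesis .
qed

lemma auc_hat_measurable [measurable (raw)]:
  assumes [measurable]: "\<And>i. w i \<in> borel_measurable M" "\<And>i. R i \<in> borel_measurable M"
    "\<And>i. T i \<in> borel_measurable M"
  shows "(\<lambda>x. auc_hat m (\<lambda>i. w i x) (\<lambda>i. R i x) (\<lambda>i. T i x)) \<in> borel_measurable M"
proof -
  have 1: "indicator {..\<alpha>} \<rho> = (if \<rho> \<le> \<alpha> then 1 else (0::real))" for \<alpha> \<rho> :: real by auto
  show ?thesis unfolding auc_hat_eq wcdf_def 1 by measurable
qed

text \<open>Linearising yields the left limit \<open>F\<^sub>0(R-)\<close> in the coefficient of \<open>T\<close>, while \<open>\<phi>\<close> has \<open>F\<^sub>0(R)\<close>.
  The difference vanishes because only the countably many atoms of \<open>r\<close> matter.\<close>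

lemma AE_no_common_jump:
  fixes T V r :: "'a \<Rightarrow> real"
  assumes fin: "finite_measure D" and [measurable]: "r \<in> borel_measurable D"
    and T: "integrable D T" "AE z in D. 0 \<le> T z" and V: "integrable D V"
    and jump: "\<And>s. (\<integral>y. (if r y = s then T y else 0) \<partial>D) = 0 \<or> (\<integral>y. (if r y = s then V y else 0) \<partial>D) = 0"
  shows "AE z in D. T z * (\<integral>y. (if r y = r z then V y else 0) \<partial>D) = 0"
proof -
  interpret D: finite_measure D by fact
  interpret R: finite_measure "distr D borel r" by (rule D.finite_measure_distr) measurable
  have [measurable]: "T \<in> borel_measurable D" "V \<in> borel_measurable D" using T V by auto
  define J where "J = {s. (\<integral>y. (if r y = s then V y else 0) \<partial>D) \<noteq> 0}"
  have "J \<subseteq> {s. measure (distr D borel r) {s} \<noteq> 0}"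
  proof (intro subsetI CollectI notI)
    fix s assume s: "s \<in> J" and 0: "measure (distr D borel r) {s} = 0"
    have "{y \<in> space D. r y = s} \<in> null_sets D"
    proof (rule null_setsI)
      show "{y \<in> space D. r y = s} \<in> sets D" by measurable
      have "r -` {s} \<inter> space D = {y \<in> space D. r y = s}" by auto
      then show "emeasure D {y \<in> space D. r y = s} = 0"
        using 0 by (simp add: measure_distr D.emeasure_eq_measure)
    qed
    then have "AE y in D. r y \<noteq> s"
      by (rule AE_I') auto
    then have "(\<integral>y. (if r y = s then V y else 0) \<partial>D) = (\<integral>y. 0 \<partial>D)"
      by (intro integral_cong_AE) auto
    with s show False by (simp add: J_def)
  qed
  then have "countable J"
    using R.countable_support countable_subset by blast
  \<comment> \<open>Where the integral of \<open>V\<close> over a level set is nonzero,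
    \<open>jump\<close> forces that of \<open>T\<close> to be zero, and nonnegativity turns this
    into \<open>T = 0\<close> almost everywhere on the level set. Countability of \<open>J\<close>
    then unites the null sets.\<close>
  moreover have "AE z in D. r z = s \<longrightarrow> T z = 0" if "s \<in> J" for s
  proof -
    have i: "integrable D (\<lambda>y. if r y = s then T y else 0)"
      by (rule Bochner_Integration.integrable_bound[OF T(1)]) auto
    have "AE y in D. 0 \<le> (if r y = s then T y else 0)" using T(2) by auto
    moreover have "(\<integral>y. (if r y = s then T y else 0) \<partial>D) = 0" using jump[of s] that by (auto simp: J_def)
    ultimately have "AE y in D. (if r y = s then T y else 0) = 0"
      using integral_nonneg_eq_0_iff_AE[OF i] by blast
    then show ?thesis by eventually_elim (auto split: if_splits)
  qed
  ultimately have "AE z in D. \<forall>s\<in>J. r z = s \<longrightarrow> T z = 0"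
    by (subst AE_ball_countable) auto
  then show ?thesis by eventually_elim (auto simp: J_def)
qed

section \<open>Asymptotic linearity of the estimated AUC\<close>

lemma pop_wcdf_if:
  "pop_wcdf Q R T s = (\<integral>z. (if R z \<le> s then T z else 0) \<partial>Q) / (\<integral>z. T z \<partial>Q)"
proof -
  have "indicator {..s} (R z) * T z = (if R z \<le> s then T z else 0)" for z by auto
  then show ?thesis by (simp add: pop_wcdf_def)
qed

lemma pop_wcdf_measurable:
  assumes "sigma_finite_measure Q"
    and [measurable]: "R \<in> borel_measurable Q" "T \<in> borel_measurable Q"
  shows "pop_wcdf Q R T \<in> borel_measurable borel"
proof -
  interpret sigma_finite_measure Q by fact
  show ?thesis unfolding pop_wcdf_if[abs_def] by measurable
qed

lemma one_minus_pop_wcdf: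
  fixes R T :: "'a \<Rightarrow> real"
  assumes [measurable]: "R \<in> borel_measurable Q" and T: "integrable Q T" and "(\<integral>z. T z \<partial>Q) \<noteq> 0"
  shows "1 - pop_wcdf Q R T s = (\<integral>z. (if s < R z then T z else 0) \<partial>Q) / (\<integral>z. T z \<partial>Q)"
proof -
  have [measurable]: "T \<in> borel_measurable Q" using T by auto
  have i: "integrable Q (\<lambda>z. if P z then T z else 0)" if [measurable]: "Measurable.pred Q P" for P
    by (rule Bochner_Integration.integrable_bound[OF T]) auto
  have "(\<integral>z. T z \<partial>Q) = (\<integral>z. (if R z \<le> s then T z else 0) + (if s < R z then T z else 0) \<partial>Q)"
    by (intro Bochner_Integration.integral_cong) auto
  also have "\<dots> = (\<integral>z. (if R z \<le> s then T z else 0) \<partial>Q) + (\<integral>z. (if s < R z then T z else 0) \<partial>Q)"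
    by (intro Bochner_Integration.integral_add i) measurable
  finally show ?thesis using assms(3) by (simp add: pop_wcdf_if field_simps)
qed

lemma (in prob_space) converges_in_prob_cong_AE:
  assumes [measurable]: "\<And>m. Z m \<in> borel_measurable M" "\<And>m. W m \<in> borel_measurable M"
    and W: "converges_in_prob M W c" and eq: "\<And>m. AE w in M. Z m w = W m w"
  shows "converges_in_prob M Z c"
proof -
  have "\<P>(w in M. \<bar>Z m w - c\<bar> > e) = \<P>(w in M. \<bar>W m w - c\<bar> > e)" for m e
    using eq[of m] by (intro finite_measure_eq_AE) auto
  then show ?thesis using W unfolding converges_in_prob_def by simp
qed

context iid_sample
begin

lemma AE_Z:
  assumes "AE z in D. P z" shows "AE w in M. P (Z i w)"
proof -
  have "AE z in distr M D (Z i). P z" using assms unfolding distr_Z .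
  then show ?thesis by (rule AE_distrD[OF Z_measurable])
qed

lemma scaled_sum_bounded_in_prob:
  fixes g :: "'z \<Rightarrow> real"
  assumes g[measurable]: "g \<in> borel_measurable D"
    and sq: "integrable D (\<lambda>z. (g z)\<^sup>2)" and mean: "(\<integral>z. g z \<partial>D) = 0"
  shows "bounded_in_prob M (\<lambda>m w. (\<Sum>i<m. g (Z i w)) / sqrt (real m))"
proof (rule bounded_in_prob_of_second_moment)
  fix m
  note * = second_moment_sum_iid[OF g sq mean, of m]
  show "integrable M (\<lambda>w. ((\<Sum>i<m. g (Z i w)) / sqrt (real m))\<^sup>2)"
    using *(1) by (simp add: power_divide)
  have "expectation (\<lambda>w. ((\<Sum>i<m. g (Z i w)) / sqrt (real m))\<^sup>2)
      = expectation (\<lambda>w. (\<Sum>i<m. g (Z i w))\<^sup>2) / real m"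
    by (simp add: power_divide)
  also have "\<dots> \<le> real m * (\<integral>z. (g z)\<^sup>2 \<partial>D) / real m"
    by (intro divide_right_mono *(2)) simp
  also have "\<dots> \<le> (\<integral>z. (g z)\<^sup>2 \<partial>D)" by (cases "m = 0") simp_all
  finally show "expectation (\<lambda>w. ((\<Sum>i<m. g (Z i w)) / sqrt (real m))\<^sup>2) \<le> (\<integral>z. (g z)\<^sup>2 \<partial>D)" .
qed measurable

text \<open>The weak law of large numbers: the centred sum over \<open>sqrt m\<close> is bounded in
  probability, and one more factor \<open>1 / sqrt m\<close> tends to 0.\<close>

lemma sample_mean_converges:
  fixes g :: "'z \<Rightarrow> real"
  assumes g[measurable]: "g \<in> borel_measurable D" and sq: "integrable D (\<lambda>z. (g z)\<^sup>2)"
  shows "converges_in_prob M (\<lambda>m w. (\<Sum>i<m. g (Z i w)) / real m) (\<integral>z. g z \<partial>D)"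
proof -
  define c where "c = (\<integral>z. g z \<partial>D)"
  have ig: "integrable D g" by (rule D.square_integrable_imp_integrable[OF g sq])
  have sq': "integrable D (\<lambda>z. (g z - c)\<^sup>2)"
    using integrable_square_add[of g D "\<lambda>_. - c"] sq by simp
  have mean: "(\<integral>z. g z - c \<partial>D) = 0" using ig by (simp add: c_def D.prob_space)
  have bd: "bounded_in_prob M (\<lambda>m w. (\<Sum>i<m. g (Z i w) - c) / sqrt (real m))"
    by (rule scaled_sum_bounded_in_prob[OF _ sq' mean]) measurable
  have "(\<lambda>m. inverse (sqrt (real m))) \<longlonglongrightarrow> 0"
    by (intro tendsto_inverse_0_at_top filterlim_compose[OF sqrt_at_top] filterlim_real_sequentially)
  then have s: "converges_in_prob M (\<lambda>m w. inverse (sqrt (real m))) 0"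
    unfolding converges_in_prob_def
  proof (intro allI impI)
    fix e :: real assume "e > 0" and "(\<lambda>m. inverse (sqrt (real m))) \<longlonglongrightarrow> 0"
    then have "\<forall>\<^sub>F m in sequentially. \<bar>inverse (sqrt (real m))\<bar> < e"
      by (auto simp: tendsto_iff dist_real_def)
    then have "\<forall>\<^sub>F m in sequentially. \<P>(w in M. \<bar>inverse (sqrt (real m)) - 0\<bar> > e) = 0"
      by eventually_elim auto
    then show "(\<lambda>m. \<P>(w in M. \<bar>inverse (sqrt (real m)) - 0\<bar> > e)) \<longlonglongrightarrow> 0"
      by (rule tendsto_eventually)
  qed
  have "converges_in_prob M (\<lambda>m w. inverse (sqrt (real m)) * ((\<Sum>i<m. g (Z i w) - c) / sqrt (real m))) 0"
    by (rule converges_in_prob_mult_bounded[OF _ _ s bd]) measurable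
  moreover have "inverse (sqrt (real m)) * (x / sqrt (real m)) = x / real m" for m x
    by (simp add: field_simps flip: power2_eq_square)
  ultimately have 1: "converges_in_prob M (\<lambda>m w. (\<Sum>i<m. g (Z i w) - c) / real m) 0" by simp
  \<comment> \<open>For \<open>m = 0\<close> the sample mean is \<open>0 / 0 = 0\<close> instead of
    \<open>c\<close>; this modified constant makes the identity with the sample mean exact for every
    \<open>m\<close>.\<close>
  have 2: "converges_in_prob M (\<lambda>m w. if m = 0 then 0 else c) c"
    unfolding converges_in_prob_def
  proof (intro allI impI tendsto_eventually)
    fix e :: real assume "e > 0"
    then show "\<forall>\<^sub>F m in sequentially. \<P>(w in M. \<bar>(if m = 0 then 0 else c) - c\<bar> > e) = 0"
      by (intro eventually_sequentiallyI[of 1]) auto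
  qed
  have "converges_in_prob M (\<lambda>m w. (\<Sum>i<m. g (Z i w) - c) / real m + (if m = 0 then 0 else c)) (0 + c)"
    by (rule converges_in_prob_add[OF _ _ 1 2]) measurable
  moreover have "(\<Sum>i<m. g (Z i w) - c) / real m + (if m = 0 then 0 else c) = (\<Sum>i<m. g (Z i w)) / real m" for m w
    by (simp add: sum_subtractf diff_divide_distrib)
  ultimately show ?thesis by (simp add: c_def)
qed

text \<open>Testing \<open>unbiased\<close> on indicators of half-lines identifies the tail
  functionals of the weighted kernel with the unweighted ones in \<open>phi_auc\<close>.
  \<open>jump\<close> is the absence of common atoms, which reconciles the strict inequality in the
  kernel with the closed one in \<open>pop_wcdf\<close>.\<close>

lemma auc_hat_linearization:
  fixes w T r :: "'z \<Rightarrow> real"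
  defines "\<theta> \<equiv> stieltjes_integral (\<lambda>\<alpha>. 1 - pop_wcdf D r T \<alpha>) (pop_wcdf D r (\<lambda>z. 1 - T z))"
    and "\<Phi> \<equiv> \<lambda>z. w z * phi_auc D r T (r z) (T z)"
  assumes [measurable]: "w \<in> borel_measurable D" "T \<in> borel_measurable D" "r \<in> borel_measurable D"
    and w: "AE z in D. \<bar>w z\<bar> \<le> W" and sqT: "integrable D (\<lambda>z. (T z)\<^sup>2)" and T0: "AE z in D. 0 \<le> T z"
    and p1: "(\<integral>z. T z \<partial>D) \<noteq> 0" and p0: "(\<integral>z. 1 - T z \<partial>D) \<noteq> 0"
    and unbiased: "\<And>g K. g \<in> borel_measurable borel \<Longrightarrow> (\<And>s. \<bar>g s\<bar> \<le> K) \<Longrightarrow>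
        (\<integral>z. g (r z) * (w z * T z) \<partial>D) = (\<integral>z. g (r z) * T z \<partial>D)"
      "\<And>g K. g \<in> borel_measurable borel \<Longrightarrow> (\<And>s. \<bar>g s\<bar> \<le> K) \<Longrightarrow>
        (\<integral>z. g (r z) * (w z * (1 - T z)) \<partial>D) = (\<integral>z. g (r z) * (1 - T z) \<partial>D)"
    and jump: "\<And>s. (\<integral>y. (if r y = s then T y else 0) \<partial>D) = 0 \<or>
        (\<integral>y. (if r y = s then 1 - T y else 0) \<partial>D) = 0"
  shows "\<Phi> \<in> borel_measurable D" and "integrable D (\<lambda>z. (\<Phi> z)\<^sup>2)" and "(\<integral>z. \<Phi> z \<partial>D) = 0"
    and "converges_in_prob M (\<lambda>m x. sqrt (real m) *
        (auc_hat m (\<lambda>i. w (Z i x)) (\<lambda>i. r (Z i x)) (\<lambda>i. T (Z i x)) - \<theta>)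
        - (\<Sum>i<m. \<Phi> (Z i x)) / sqrt (real m)) 0"
proof -
  define a b where "a z = w z * T z" and "b z = w z * (1 - T z)" for z
  have [measurable]: "a \<in> borel_measurable D" "b \<in> borel_measurable D"
    unfolding a_def b_def by measurable
  have sqT': "integrable D (\<lambda>z. (1 - T z)\<^sup>2)"
    using integrable_square_add[of "\<lambda>_. 1" D "\<lambda>z. - T z"] sqT by simp
  have sqa: "integrable D (\<lambda>z. (a z)\<^sup>2)" and sqb: "integrable D (\<lambda>z. (b z)\<^sup>2)"
    unfolding a_def b_def using w sqT sqT' by (auto intro!: integrable_square_bounded_mult)
  have iT: "integrable D T" by (rule D.square_integrable_imp_integrable[OF _ sqT]) measurable
  have iT': "integrable D (\<lambda>z. 1 - T z)" using iT by simp
  have ia: "integrable D a" by (rule D.square_integrable_imp_integrable[OF _ sqa]) measurable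
  have ib: "integrable D b" by (rule D.square_integrable_imp_integrable[OF _ sqb]) measurable
  define P1 P0 where "P1 = (\<integral>z. T z \<partial>D)" and "P0 = (\<integral>z. 1 - T z \<partial>D)"
  have P: "P1 \<noteq> 0" "P0 \<noteq> 0" using p1 p0 by (simp_all add: P1_def P0_def)
  have Ea: "(\<integral>z. a z \<partial>D) = P1" and Eb: "(\<integral>z. b z \<partial>D) = P0"
    using unbiased(1)[of "\<lambda>_. 1" 1] unbiased(2)[of "\<lambda>_. 1" 1] by (simp_all add: a_def b_def P1_def P0_def)
  define \<beta> \<alpha> where "\<beta> s = (\<integral>y. (if r y < s then b y else 0) \<partial>D)"
    and "\<alpha> s = (\<integral>x. (if s < r x then a x else 0) \<partial>D)" for s
  define \<mu> where "\<mu> = (\<integral>x. a x * \<beta> (r x) \<partial>D)"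
  note U = ustat_linearization[of a b r, OF _ _ _ sqa sqb, folded \<beta>_def \<alpha>_def, folded \<mu>_def, simplified]
  have \<beta>: "\<beta> s = (\<integral>y. (if r y < s then 1 - T y else 0) \<partial>D)" for s
  proof -
    have "indicator {..<s} v * x = (if v < s then x else (0::real))" for v x by simp
    then show ?thesis using unbiased(2)[of "indicator {..<s}" 1] unfolding \<beta>_def b_def by simp
  qed
  have \<alpha>: "\<alpha> s = (\<integral>y. (if s < r y then T y else 0) \<partial>D)" for s
  proof -
    have "indicator {s<..} v * x = (if s < v then x else (0::real))" for v x by simp
    then show ?thesis using unbiased(1)[of "indicator {s<..}" 1] unfolding \<alpha>_def a_def by simp
  qed
  have [measurable]: "\<alpha> \<in> borel_measurable borel" "\<beta> \<in> borel_measurable borel"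
    unfolding \<alpha>_def[abs_def] \<beta>_def[abs_def] by measurable
  have \<alpha>_le: "\<bar>\<alpha> s\<bar> \<le> (\<integral>z. \<bar>a z\<bar> \<partial>D)" for s
    unfolding \<alpha>_def by (rule D.abs_integral_if_le[OF ia]) measurable
  have F1: "1 - pop_wcdf D r T s = \<alpha> s / P1" for s
    using one_minus_pop_wcdf[OF _ iT p1] unfolding \<alpha> P1_def by simp
  \<comment> \<open>\<open>\<beta>\<close> is the left limit of the unnormalised distribution
    function; what it misses is the mass of the level set \<open>r y = s\<close>.\<close>
  have F0: "pop_wcdf D r (\<lambda>z. 1 - T z) s = (\<beta> s + (\<integral>y. (if r y = s then 1 - T y else 0) \<partial>D)) / P0" for s
  proof -
    have i: "integrable D (\<lambda>z. if P z then 1 - T z else 0)" if [measurable]: "Measurable.pred D P" for P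
      by (rule Bochner_Integration.integrable_bound[OF iT']) auto
    have "(\<integral>y. (if r y \<le> s then 1 - T y else 0) \<partial>D)
        = (\<integral>y. (if r y < s then 1 - T y else 0) + (if r y = s then 1 - T y else 0) \<partial>D)"
      by (intro Bochner_Integration.integral_cong) auto
    also have "\<dots> = \<beta> s + (\<integral>y. (if r y = s then 1 - T y else 0) \<partial>D)"
      unfolding \<beta> by (intro Bochner_Integration.integral_add i) measurable
    finally show ?thesis by (simp add: pop_wcdf_if P0_def)
  qed
  have \<theta>: "\<theta> * (P1 * P0) = \<mu>"
  proof -
    have "integrable D (\<lambda>z. \<alpha> (r z) / P1 * (1 - T z))"
    proof (rule Bochner_Integration.integrable_bound)
      show "integrable D (\<lambda>z. (\<integral>z. \<bar>a z\<bar> \<partial>D) / P1 * (1 - T z))" using iT' by simp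
      have "\<bar>\<alpha> s\<bar> \<le> \<bar>(\<integral>z. \<bar>a z\<bar> \<partial>D)\<bar>" for s using \<alpha>_le[of s] by linarith
      then show "AE z in D. norm (\<alpha> (r z) / P1 * (1 - T z)) \<le> norm ((\<integral>z. \<bar>a z\<bar> \<partial>D) / P1 * (1 - T z))"
        by (auto simp: abs_mult intro!: mult_right_mono divide_right_mono)
    qed measurable
    then have "\<theta> = (\<integral>z. \<alpha> (r z) / P1 * (1 - T z) \<partial>D) / P0"
      unfolding \<theta>_def F1 P0_def using iT' by (intro stieltjes_integral_pop_wcdf) auto
    also have "(\<integral>z. \<alpha> (r z) / P1 * (1 - T z) \<partial>D) = (\<integral>z. \<alpha> (r z) * (1 - T z) \<partial>D) / P1"
      by simp
    also have "(\<integral>z. \<alpha> (r z) * (1 - T z) \<partial>D) = (\<integral>z. \<alpha> (r z) * b z \<partial>D)"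
      \<comment> \<open>Here \<open>\<alpha>\<close> itself is the bounded test function in
        \<open>unbiased\<close>, which exchanges \<open>1 - T\<close> for the weighted
        \<open>b\<close>.\<close>
      unfolding b_def using \<alpha>_le by (intro unbiased(2)[symmetric]) auto
    also have "\<dots> = \<mu>" using U(1) by (simp add: mult.commute)
    finally show ?thesis using P by simp
  qed
  have phi: "phi_auc D r T \<rho> t = (1 - t) / P0 * (\<alpha> \<rho> / P1)
      + t / P1 * pop_wcdf D r (\<lambda>z. 1 - T z) \<rho> - ((1 - t) / P0 + t / P1) * \<theta>" for \<rho> t
  proof -
    have tail: "(\<integral>z. indicator {s<..} (r z) * T z \<partial>D) / (\<integral>z. T z \<partial>D) = 1 - pop_wcdf D r T s" for s
      unfolding F1 \<alpha> P1_def
      by (intro arg_cong2[where f = "(/)"] Bochner_Integration.integral_cong) auto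
    show ?thesis
      unfolding phi_auc_def tail \<theta>_def[symmetric] unfolding F1 P1_def P0_def ..
  qed
  have [measurable]: "pop_wcdf D r (\<lambda>z. 1 - T z) \<in> borel_measurable borel"
    by (intro pop_wcdf_measurable D.sigma_finite_measure_axioms) measurable
  show \<Phi>m[measurable]: "\<Phi> \<in> borel_measurable D"
    unfolding \<Phi>_def phi by measurable
  \<comment> \<open>The influence function of the numerator \<open>u - \<theta> * (S1 * S0)\<close>:
    the two projections of the V-statistic less the first-order part of the product of the sample
    means.\<close>
  define \<psi> where "\<psi> z = a z * \<beta> (r z) + b z * \<alpha> (r z) - \<theta> * (P0 * a z + P1 * b z)" for z
  have [measurable]: "\<psi> \<in> borel_measurable D" unfolding \<psi>_def by measurable
  \<comment> \<open>The tie mass \<open>J\<close> occurs in \<open>\<Phi>\<close> only in the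
    product \<open>T z * J\<close>, which is zero almost everywhere.\<close>
  have \<Phi>\<psi>: "AE z in D. \<Phi> z = \<psi> z / (P1 * P0)"
    using AE_no_common_jump[OF D.finite_measure_axioms _ iT T0 iT' jump, simplified]
  proof eventually_elim
    case (elim z)
    define J where "J = (\<integral>y. (if r y = r z then 1 - T y else 0) \<partial>D)"
    from elim have TJ: "T z * J = 0" by (simp add: J_def)
    have "\<Phi> z = (w z * (1 - T z) * \<alpha> (r z) + w z * T z * \<beta> (r z) + w z * (T z * J)
        - \<theta> * (P1 * (w z * (1 - T z)) + P0 * (w z * T z))) / (P1 * P0)"
      using P unfolding \<Phi>_def phi F0 J_def[symmetric] by (simp add: field_simps)
    then show ?case unfolding TJ by (simp add: \<psi>_def a_def b_def algebra_simps)
  qed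
  have sq\<psi>: "integrable D (\<lambda>z. (\<psi> z)\<^sup>2)"
  proof -
    have 1: "integrable D (\<lambda>z. (a z * \<beta> (r z) + b z * \<alpha> (r z))\<^sup>2)"
      by (rule integrable_square_add[OF _ _ U(2,3)]) measurable
    have 2: "integrable D (\<lambda>z. ((- \<theta> * P0) * a z + (- \<theta> * P1) * b z)\<^sup>2)"
      by (rule integrable_square_add) (use sqa sqb in \<open>auto simp: power_mult_distrib\<close>)
    have "integrable D (\<lambda>z. ((a z * \<beta> (r z) + b z * \<alpha> (r z)) + ((- \<theta> * P0) * a z + (- \<theta> * P1) * b z))\<^sup>2)"
      by (rule integrable_square_add[OF _ _ 1 2]) measurable
    then show ?thesis by (simp add: \<psi>_def algebra_simps)
  qed
  have i\<beta>: "integrable D (\<lambda>x. a x * \<beta> (r x))"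
    by (rule D.square_integrable_imp_integrable[OF _ U(2)]) measurable
  have i\<alpha>: "integrable D (\<lambda>x. b x * \<alpha> (r x))"
    by (rule D.square_integrable_imp_integrable[OF _ U(3)]) measurable
  have mean\<psi>: "(\<integral>z. \<psi> z \<partial>D) = 0"
  proof -
    have "(\<integral>z. \<psi> z \<partial>D) = \<mu> + \<mu> - \<theta> * (P0 * P1 + P1 * P0)"
      unfolding \<psi>_def using i\<beta> i\<alpha> ia ib by (simp add: Ea Eb U(1) flip: \<mu>_def)
    then show ?thesis using \<theta> by (simp add: algebra_simps)
  qed
  show "integrable D (\<lambda>z. (\<Phi> z)\<^sup>2)"
  proof -
    have "integrable D (\<lambda>z. (\<psi> z / (P1 * P0))\<^sup>2)" using sq\<psi> by (simp add: power_divide)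
    moreover have "AE z in D. (\<Phi> z)\<^sup>2 = (\<psi> z / (P1 * P0))\<^sup>2" using \<Phi>\<psi> by eventually_elim simp
    ultimately show ?thesis by (subst integrable_cong_AE[where g = "\<lambda>z. (\<psi> z / (P1 * P0))\<^sup>2"]) measurable
  qed
  show "(\<integral>z. \<Phi> z \<partial>D) = 0"
  proof -
    have "(\<integral>z. \<Phi> z \<partial>D) = (\<integral>z. \<psi> z / (P1 * P0) \<partial>D)" using \<Phi>\<psi> by (intro integral_cong_AE) measurable
    then show ?thesis using mean\<psi> by simp
  qed
  define S1 S0 where "S1 m x = (\<Sum>i<m. a (Z i x)) / real m" and "S0 m x = (\<Sum>i<m. b (Z i x)) / real m" for m x
  define V where "V m x = sqrt (real m) *
    (auc_hat m (\<lambda>i. w (Z i x)) (\<lambda>i. r (Z i x)) (\<lambda>i. T (Z i x)) - \<theta>)" for m x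
  define u where "u m x = (\<Sum>i<m. \<Sum>j<m. if r (Z j x) < r (Z i x) then a (Z i x) * b (Z j x) else 0) / (real m)\<^sup>2" for m x
  define N where "N m x = sqrt (real m) * (u m x - \<theta> * (S1 m x * S0 m x))" for m x
  define L where "L m x = (\<Sum>i<m. \<psi> (Z i x)) / sqrt (real m)" for m x
  have [measurable]: "S1 m \<in> borel_measurable M" "S0 m \<in> borel_measurable M" "V m \<in> borel_measurable M"
    "u m \<in> borel_measurable M" "N m \<in> borel_measurable M" "L m \<in> borel_measurable M" for m
    unfolding S1_def[abs_def] S0_def[abs_def] V_def[abs_def] u_def[abs_def] N_def[abs_def] L_def[abs_def]
    by measurable
  have S1: "converges_in_prob M S1 P1" and S0: "converges_in_prob M S0 P0"
    using sample_mean_converges[OF _ sqa] sample_mean_converges[OF _ sqb]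
    unfolding S1_def[abs_def] S0_def[abs_def] Ea Eb by simp_all
  have NL: "converges_in_prob M (\<lambda>m x. N m x - L m x) 0"
  proof -
    define E where "E m x = sqrt (real m) * (u m x - \<mu>) -
      (\<Sum>i<m. a (Z i x) * \<beta> (r (Z i x)) + b (Z i x) * \<alpha> (r (Z i x)) - 2 * \<mu>) / sqrt (real m)" for m x
    \<comment> \<open>For positive \<open>m\<close> this is \<open>sqrt m * (S1 - P1)\<close>. The
      second-order part of \<open>S1 * S0\<close> around its limit, times \<open>sqrt m\<close>, is
      \<open>(S0 - P0) * A\<close>, a null sequence times one bounded in probability; together with
      \<open>E\<close> it makes up the whole remainder.\<close>
    define A where "A m x = (\<Sum>i<m. a (Z i x) - P1) / sqrt (real m)" for m x
    have [measurable]: "E m \<in> borel_measurable M" "A m \<in> borel_measurable M" for m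
      unfolding E_def[abs_def] A_def[abs_def] by measurable
    have E: "converges_in_prob M E 0" using U(4) unfolding E_def[abs_def] u_def .
    have A: "bounded_in_prob M A"
      unfolding A_def[abs_def]
    proof (rule scaled_sum_bounded_in_prob)
      show "integrable D (\<lambda>z. (a z - P1)\<^sup>2)"
        using integrable_square_add[of a D "\<lambda>_. - P1"] sqa by simp
      show "(\<integral>z. a z - P1 \<partial>D) = 0" using ia by (simp add: Ea D.prob_space)
    qed measurable
    have "converges_in_prob M (\<lambda>m x. S0 m x - P0) (P0 - P0)"
      by (rule converges_in_prob_diff[OF _ _ S0]) (auto simp: converges_in_prob_def)
    then have "converges_in_prob M (\<lambda>m x. (S0 m x - P0) * A m x) 0"
      by (intro converges_in_prob_mult_bounded A) auto
    then have "converges_in_prob M (\<lambda>m x. \<theta> * ((S0 m x - P0) * A m x)) (\<theta> * 0)"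
      by (intro converges_in_prob_cmult) measurable
    then have "converges_in_prob M (\<lambda>m x. E m x - \<theta> * ((S0 m x - P0) * A m x)) (0 - \<theta> * 0)"
      by (intro converges_in_prob_diff E) measurable
    moreover have "N m x - L m x = E m x - \<theta> * ((S0 m x - P0) * A m x)" for m x
    proof (cases "m = 0")
      case False
      then have s: "sqrt (real m) * sqrt (real m) = real m" "sqrt (real m) > 0" by auto
      define sa sb sc where "sa = (\<Sum>i<m. a (Z i x))" and "sb = (\<Sum>i<m. b (Z i x))"
        and "sc = (\<Sum>i<m. a (Z i x) * \<beta> (r (Z i x)) + b (Z i x) * \<alpha> (r (Z i x)))"
      have L: "L m x = (sc - \<theta> * (P0 * sa + P1 * sb)) / sqrt (real m)"
        by (simp add: L_def \<psi>_def sum_subtractf sc_def sa_def sb_def sum.distrib sum_distrib_left algebra_simps)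
      have A': "A m x = (sa - real m * P1) / sqrt (real m)"
        by (simp add: A_def sa_def sum_subtractf)
      have E': "E m x = sqrt (real m) * (u m x - \<mu>) - (sc - real m * (2 * \<mu>)) / sqrt (real m)"
        by (simp add: E_def sc_def sum_subtractf)
      have S: "S1 m x = sa / real m" "S0 m x = sb / real m" by (simp_all add: S1_def S0_def sa_def sb_def)
      define q where "q = sqrt (real m)"
      have q: "q > 0" "real m = q * q" using s by (simp_all add: q_def)
      show ?thesis
        unfolding N_def L A' E' S \<theta>[symmetric] q_def[symmetric] q(2)
        using q(1) by (simp add: field_simps power2_eq_square)
    qed (simp add: N_def L_def E_def A_def)
    ultimately show ?thesis by simp
  qed
  have D: "converges_in_prob M (\<lambda>m x. S1 m x * S0 m x) (P1 * P0)"
    by (intro converges_in_prob_mult S1 S0) measurable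
  have L: "bounded_in_prob M L"
    unfolding L_def[abs_def] by (rule scaled_sum_bounded_in_prob[OF _ sq\<psi> mean\<psi>]) measurable
  have "converges_in_prob M (\<lambda>m x. V m x - L m x / (P1 * P0)) 0"
  proof (rule converges_in_prob_ratio[OF _ _ _ _ NL L D])
    fix m x assume ne: "S1 m x * S0 m x \<noteq> 0"
    then have m: "m \<noteq> 0" by (auto simp: S1_def)
    have "auc_hat m (\<lambda>i. w (Z i x)) (\<lambda>i. r (Z i x)) (\<lambda>i. T (Z i x)) *
        ((\<Sum>i<m. a (Z i x)) * (\<Sum>i<m. b (Z i x))) = (real m)\<^sup>2 * u m x"
      using ne m unfolding a_def b_def u_def S1_def S0_def by (subst auc_hat_mult) auto
    then have "auc_hat m (\<lambda>i. w (Z i x)) (\<lambda>i. r (Z i x)) (\<lambda>i. T (Z i x)) * (S1 m x * S0 m x) = u m x"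
      using m unfolding S1_def S0_def by (simp add: field_simps power2_eq_square)
    then show "V m x * (S1 m x * S0 m x) = N m x"
      unfolding V_def N_def by (simp add: algebra_simps)
  qed (use P in \<open>simp_all\<close>)
  then have "converges_in_prob M (\<lambda>m x. V m x - (\<Sum>i<m. \<Phi> (Z i x)) / sqrt (real m)) 0"
  proof (rule converges_in_prob_cong_AE[rotated 2])
    fix m
    have "AE x in M. \<forall>i\<in>{..<m}. \<Phi> (Z i x) = \<psi> (Z i x) / (P1 * P0)"
      using AE_Z[OF \<Phi>\<psi>] by (intro AE_finite_allI) auto
    then show "AE x in M. V m x - (\<Sum>i<m. \<Phi> (Z i x)) / sqrt (real m) = V m x - L m x / (P1 * P0)"
      by eventually_elim (simp add: L_def mult.commute flip: sum_divide_distrib)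
  qed measurable
  then show "converges_in_prob M (\<lambda>m x. sqrt (real m) *
        (auc_hat m (\<lambda>i. w (Z i x)) (\<lambda>i. r (Z i x)) (\<lambda>i. T (Z i x)) - \<theta>)
        - (\<Sum>i<m. \<Phi> (Z i x)) / sqrt (real m)) 0"
    unfolding V_def .
qed

end

section \<open>Missingness at random\<close>

text \<open>By dominated convergence, the increments over the half-open intervals from
  \<open>u n\<close> to \<open>s\<close>, times the total mass, tend to the integral over the level
  set \<open>R z = s\<close>; continuity sends the same increments to 0. This turns continuity
  assumptions into the atom condition \<open>jump\<close>.\<close>

lemma isCont_pop_wcdf_no_jump:
  fixes R T :: "'a \<Rightarrow> real"
  assumes [measurable]: "R \<in> borel_measurable Q" and T: "integrable Q T" and T0: "(\<integral>z. T z \<partial>Q) \<noteq> 0"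
    and cont: "isCont (pop_wcdf Q R T) s"
  shows "(\<integral>z. (if R z = s then T z else 0) \<partial>Q) = 0"
proof -
  have [measurable]: "T \<in> borel_measurable Q" using T by auto
  have i: "integrable Q (\<lambda>z. if P z then T z else 0)" if [measurable]: "Measurable.pred Q P" for P
    by (rule Bochner_Integration.integrable_bound[OF T]) auto
  define u where "u n = s + - inverse (real (Suc n))" for n
  have u: "u \<longlonglongrightarrow> s" unfolding u_def by (rule LIMSEQ_inverse_real_of_nat_add_minus)
  have u_less: "u n < s" for n by (simp add: u_def)
  have "(\<lambda>n. pop_wcdf Q R T s - pop_wcdf Q R T (u n)) \<longlonglongrightarrow> pop_wcdf Q R T s - pop_wcdf Q R T s"
    by (intro tendsto_diff tendsto_const isCont_tendsto_compose[OF cont u])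
  then have "(\<lambda>n. (pop_wcdf Q R T s - pop_wcdf Q R T (u n)) * (\<integral>z. T z \<partial>Q)) \<longlonglongrightarrow> 0"
    using tendsto_mult_left_zero by fastforce
  moreover have "(pop_wcdf Q R T s - pop_wcdf Q R T (u n)) * (\<integral>z. T z \<partial>Q)
      = (\<integral>z. (if u n < R z \<and> R z \<le> s then T z else 0) \<partial>Q)" for n
  proof -
    have "(pop_wcdf Q R T s - pop_wcdf Q R T (u n)) * (\<integral>z. T z \<partial>Q)
        = (\<integral>z. (if R z \<le> s then T z else 0) \<partial>Q) - (\<integral>z. (if R z \<le> u n then T z else 0) \<partial>Q)"
      using T0 by (simp add: pop_wcdf_if field_simps)
    also have "\<dots> = (\<integral>z. (if R z \<le> s then T z else 0) - (if R z \<le> u n then T z else 0) \<partial>Q)"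
      by (intro Bochner_Integration.integral_diff[symmetric] i) measurable
    also have "\<dots> = (\<integral>z. (if u n < R z \<and> R z \<le> s then T z else 0) \<partial>Q)"
      using u_less[of n] by (intro Bochner_Integration.integral_cong) auto
    finally show ?thesis .
  qed
  ultimately have 1: "(\<lambda>n. \<integral>z. (if u n < R z \<and> R z \<le> s then T z else 0) \<partial>Q) \<longlonglongrightarrow> 0" by simp
  have 2: "(\<lambda>n. \<integral>z. (if u n < R z \<and> R z \<le> s then T z else 0) \<partial>Q)
      \<longlonglongrightarrow> (\<integral>z. (if R z = s then T z else 0) \<partial>Q)"
  proof (rule integral_dominated_convergence[where w = "\<lambda>z. \<bar>T z\<bar>"])
    show "AE z in Q. (\<lambda>n. if u n < R z \<and> R z \<le> s then T z else 0) \<longlonglongrightarrow> (if R z = s then T z else 0)"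
    proof (rule AE_I2)
      fix z
      show "(\<lambda>n. if u n < R z \<and> R z \<le> s then T z else 0) \<longlonglongrightarrow> (if R z = s then T z else 0)"
      proof (cases "R z < s")
        case True
        have "\<forall>\<^sub>F n in sequentially. R z < u n" by (rule order_tendstoD(1)[OF u True])
        then have "\<forall>\<^sub>F n in sequentially. (if u n < R z \<and> R z \<le> s then T z else 0) = 0"
          by eventually_elim auto
        then show ?thesis using True tendsto_eventually by auto
      qed (use u_less in auto)
    qed
  qed (use T in auto)
  show ?thesis by (rule LIMSEQ_unique[OF 2 1])
qed

lemma pop_wcdf_distr:
  assumes [measurable]: "G \<in> measurable Q N" "r \<in> borel_measurable N" "T \<in> borel_measurable N"
  shows "pop_wcdf (distr Q N G) r T = pop_wcdf Q (\<lambda>z. r (G z)) (\<lambda>z. T (G z))"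
  unfolding pop_wcdf_if[abs_def] by (simp add: integral_distr)

lemma phi_auc_distr:
  assumes [measurable]: "G \<in> measurable Q N" "r \<in> borel_measurable N" "T \<in> borel_measurable N"
  shows "phi_auc (distr Q N G) r T = phi_auc Q (\<lambda>z. r (G z)) (\<lambda>z. T (G z))"
proof -
  have 1: "indicator {s<..} x * y = (if s < x then y else 0)" for s x y :: real by simp
  show ?thesis
    unfolding phi_auc_def[abs_def] 1 by (simp add: integral_distr pop_wcdf_distr)
qed

text \<open>Almost everywhere \<open>Y\<close> and \<open>1 - Y\<close> are the indicators of the
  two conditioning events, so the binary outcome becomes an instance of a general real-valued
  \<open>T\<close>.\<close>

lemma (in prob_space) cond_prob_eq_pop_wcdf:
  fixes R Y :: "'a \<Rightarrow> real"
  assumes [measurable]: "R \<in> borel_measurable M" "Y \<in> borel_measurable M"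
    and Y: "AE z in M. Y z \<in> {0, 1}"
  shows "\<P>(z in M. R z \<le> a \<bar> Y z = 1) = pop_wcdf M R Y a"
    and "\<P>(z in M. R z > a \<bar> Y z = 1) = (\<integral>z. (if a < R z then Y z else 0) \<partial>M) / (\<integral>z. Y z \<partial>M)"
    and "\<P>(z in M. R z \<le> a \<bar> Y z = 0) = pop_wcdf M R (\<lambda>z. 1 - Y z) a"
    and "\<P>(z in M. Y z = 1) = (\<integral>z. Y z \<partial>M)" and "\<P>(z in M. Y z = 0) = (\<integral>z. 1 - Y z \<partial>M)"
proof -
  have 1: "\<P>(z in M. P z \<and> Y z = 1) = (\<integral>z. (if P z then Y z else 0) \<partial>M)"
    and 0: "\<P>(z in M. P z \<and> Y z = 0) = (\<integral>z. (if P z then 1 - Y z else 0) \<partial>M)"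
    if [measurable]: "Measurable.pred M P" for P
  proof -
    have "\<P>(z in M. P z \<and> Y z = 1) = (\<integral>z. indicator {z \<in> space M. P z \<and> Y z = 1} z \<partial>M)" by simp
    also have "\<dots> = (\<integral>z. (if P z then Y z else 0) \<partial>M)"
    proof (rule integral_cong_AE)
      show "AE z in M. indicator {z \<in> space M. P z \<and> Y z = 1} z = (if P z then Y z else 0)"
        using Y AE_space by eventually_elim auto
    qed measurable
    finally show "\<P>(z in M. P z \<and> Y z = 1) = (\<integral>z. (if P z then Y z else 0) \<partial>M)" .
    have "\<P>(z in M. P z \<and> Y z = 0) = (\<integral>z. indicator {z \<in> space M. P z \<and> Y z = 0} z \<partial>M)" by simp
    also have "\<dots> = (\<integral>z. (if P z then 1 - Y z else 0) \<partial>M)"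
    proof (rule integral_cong_AE)
      show "AE z in M. indicator {z \<in> space M. P z \<and> Y z = 0} z = (if P z then 1 - Y z else 0)"
        using Y AE_space by eventually_elim auto
    qed measurable
    finally show "\<P>(z in M. P z \<and> Y z = 0) = (\<integral>z. (if P z then 1 - Y z else 0) \<partial>M)" .
  qed
  show Y1: "\<P>(z in M. Y z = 1) = (\<integral>z. Y z \<partial>M)" and Y0: "\<P>(z in M. Y z = 0) = (\<integral>z. 1 - Y z \<partial>M)"
    using 1[of "\<lambda>_. True"] 0[of "\<lambda>_. True"] by simp_all
  show "\<P>(z in M. R z \<le> a \<bar> Y z = 1) = pop_wcdf M R Y a"
    and "\<P>(z in M. R z > a \<bar> Y z = 1) = (\<integral>z. (if a < R z then Y z else 0) \<partial>M) / (\<integral>z. Y z \<partial>M)"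
    and "\<P>(z in M. R z \<le> a \<bar> Y z = 0) = pop_wcdf M R (\<lambda>z. 1 - Y z) a"
    unfolding cond_prob_def Y1 Y0 pop_wcdf_if by (simp_all add: 1 0)
qed

locale missing_at_random = prob_space Q for Q :: "'q measure" +
  fixes X :: "'q \<Rightarrow> 'x::topological_space" and C Y :: "'q \<Rightarrow> real" and \<pi> :: "'x \<Rightarrow> real" and \<epsilon> :: real
  assumes X [measurable]: "X \<in> borel_measurable Q" and C [measurable]: "C \<in> borel_measurable Q"
    and Y [measurable]: "Y \<in> borel_measurable Q"
    and C01: "AE z in Q. C z \<in> {0, 1}" and Y01: "AE z in Q. Y z \<in> {0, 1}"
    and \<pi> [measurable]: "\<pi> \<in> borel_measurable borel"
    and propensity: "AE z in Q. cond_prob_given Q X {y \<in> space Q. C y = 1} z = \<pi> (X z)"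
    and \<epsilon>: "\<epsilon> > 0" and positivity: "AE z in Q. \<epsilon> < \<pi> (X z)"
    and MAR: "cond_indep_given Q C Y X"
begin

abbreviation \<F> where "\<F> \<equiv> vimage_algebra (space Q) X borel"

sublocale F: finite_measure_subalgebra Q \<F>
proof
  show "subalgebra Q \<F>"
    unfolding subalgebra_def using sets_image_in_sets[OF _ X] by simp
qed

lemma X_F_measurable [measurable]: "X \<in> borel_measurable \<F>"
  by (rule measurable_vimage_algebra1) auto

lemma weight_bounded: "AE z in Q. \<bar>C z / \<pi> (X z)\<bar> \<le> 1 / \<epsilon>"
  using C01 positivity
proof eventually_elim
  case (elim z)
  then show ?case using \<epsilon> by (auto simp: field_simps)
qed

text \<open>Given \<open>X\<close>, the indicator \<open>C\<close> has mean
  \<open>\<pi> (X z)\<close>, which cancels the weight. Positivity bounds the weight by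
  \<open>1 / \<epsilon>\<close>, so the conditional expectation is applied to an integrable
  function.\<close>

lemma integral_weight:
  assumes [measurable]: "h \<in> borel_measurable borel" and h: "integrable Q (\<lambda>z. h (X z))"
  shows "(\<integral>z. C z / \<pi> (X z) * h (X z) \<partial>Q) = (\<integral>z. h (X z) \<partial>Q)"
proof -
  let ?A = "{y \<in> space Q. C y = 1}"
  have A[measurable]: "?A \<in> sets Q" by measurable
  have eq: "AE z in Q. C z / \<pi> (X z) * h (X z) = h (X z) / \<pi> (X z) * indicator ?A z"
    using C01 AE_space by eventually_elim auto
  have int: "integrable Q (\<lambda>z. C z / \<pi> (X z) * h (X z))"
  proof (rule Bochner_Integration.integrable_bound)
    show "integrable Q (\<lambda>z. 1 / \<epsilon> * h (X z))" using h by simp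
    show "AE z in Q. norm (C z / \<pi> (X z) * h (X z)) \<le> norm (1 / \<epsilon> * h (X z))"
      using weight_bounded
    proof eventually_elim
      case (elim z)
      then have "\<bar>C z / \<pi> (X z)\<bar> * \<bar>h (X z)\<bar> \<le> 1 / \<epsilon> * \<bar>h (X z)\<bar>" by (rule mult_right_mono) simp
      then show ?case using \<epsilon> by (simp add: abs_mult)
    qed
  qed measurable
  have "(\<integral>z. C z / \<pi> (X z) * h (X z) \<partial>Q) = (\<integral>z. h (X z) / \<pi> (X z) * indicator ?A z \<partial>Q)"
    by (rule integral_cong_AE[OF _ _ eq]) measurable
  also have "\<dots> = (\<integral>z. h (X z) / \<pi> (X z) * cond_prob_given Q X ?A z \<partial>Q)"
    unfolding cond_prob_given_def
  proof (rule F.real_cond_exp_intg(2)[symmetric])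
    show "integrable Q (\<lambda>z. h (X z) / \<pi> (X z) * indicator ?A z)"
      using int eq by (subst integrable_cong_AE[symmetric, OF _ _ eq]) auto
  qed measurable
  also have "\<dots> = (\<integral>z. h (X z) \<partial>Q)"
  proof (rule integral_cong_AE)
    show "(\<lambda>z. h (X z) / \<pi> (X z) * cond_prob_given Q X ?A z) \<in> borel_measurable Q"
      unfolding cond_prob_given_def by measurable
    show "AE z in Q. h (X z) / \<pi> (X z) * cond_prob_given Q X ?A z = h (X z)"
      using propensity positivity by eventually_elim (use \<epsilon> in auto)
  qed measurable
  finally show ?thesis .
qed

text \<open>Conditional independence factors the conditional probability of \<open>C = 1\<close> and
  \<open>Y = 1\<close> into \<open>\<pi> (X z)\<close> and the conditional probability of
  \<open>Y = 1\<close>. The first factor cancels the weight, and the second is integrated back to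
  \<open>Y\<close>.\<close>

lemma integral_weight_Y:
  assumes [measurable]: "h \<in> borel_measurable borel" and h: "integrable Q (\<lambda>z. h (X z))"
  shows "(\<integral>z. C z / \<pi> (X z) * (h (X z) * Y z) \<partial>Q) = (\<integral>z. h (X z) * Y z \<partial>Q)"
proof -
  let ?A = "{y \<in> space Q. C y = 1}" and ?B = "{y \<in> space Q. Y y = 1}"
    and ?AB = "{y \<in> space Q. C y = 1 \<and> Y y = 1}"
  have A[measurable]: "?A \<in> sets Q" "?B \<in> sets Q" "?AB \<in> sets Q" by measurable
  have eq: "AE z in Q. C z / \<pi> (X z) * (h (X z) * Y z) = h (X z) / \<pi> (X z) * indicator ?AB z"
    using C01 Y01 AE_space by eventually_elim auto
  have eqB: "AE z in Q. h (X z) * Y z = h (X z) * indicator ?B z"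
    using Y01 AE_space by eventually_elim auto
  have intB: "integrable Q (\<lambda>z. h (X z) * indicator ?B z)"
    by (rule Bochner_Integration.integrable_bound[OF h]) (auto split: split_indicator)
  have int: "integrable Q (\<lambda>z. h (X z) / \<pi> (X z) * indicator ?AB z)"
  proof (rule Bochner_Integration.integrable_bound)
    show "integrable Q (\<lambda>z. 1 / \<epsilon> * h (X z))" using h by simp
    show "AE z in Q. norm (h (X z) / \<pi> (X z) * indicator ?AB z) \<le> norm (1 / \<epsilon> * h (X z))"
      using positivity
    proof eventually_elim
      case (elim z)
      then have "\<bar>h (X z)\<bar> / \<pi> (X z) \<le> \<bar>h (X z)\<bar> / \<epsilon>"
        using \<epsilon> by (intro divide_left_mono) auto
      then show ?case using \<epsilon> elim by (auto split: split_indicator)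
    qed
  qed measurable
  have indep: "AE z in Q. cond_prob_given Q X ?AB z = cond_prob_given Q X ?A z * cond_prob_given Q X ?B z"
    using MAR[unfolded cond_indep_given_def, rule_format, of "{1}" "{1}"] by simp
  have "(\<integral>z. C z / \<pi> (X z) * (h (X z) * Y z) \<partial>Q) = (\<integral>z. h (X z) / \<pi> (X z) * indicator ?AB z \<partial>Q)"
    by (rule integral_cong_AE[OF _ _ eq]) measurable
  also have "\<dots> = (\<integral>z. h (X z) / \<pi> (X z) * cond_prob_given Q X ?AB z \<partial>Q)"
    unfolding cond_prob_given_def by (rule F.real_cond_exp_intg(2)[symmetric, OF int]) measurable
  also have "\<dots> = (\<integral>z. h (X z) * cond_prob_given Q X ?B z \<partial>Q)"
  proof (rule integral_cong_AE)
    show "(\<lambda>z. h (X z) / \<pi> (X z) * cond_prob_given Q X ?AB z) \<in> borel_measurable Q"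
      "(\<lambda>z. h (X z) * cond_prob_given Q X ?B z) \<in> borel_measurable Q"
      unfolding cond_prob_given_def by measurable
    show "AE z in Q. h (X z) / \<pi> (X z) * cond_prob_given Q X ?AB z = h (X z) * cond_prob_given Q X ?B z"
      using indep propensity positivity by eventually_elim (use \<epsilon> in auto)
  qed
  also have "\<dots> = (\<integral>z. h (X z) * indicator ?B z \<partial>Q)"
    unfolding cond_prob_given_def by (rule F.real_cond_exp_intg(2)[OF intB]) measurable
  also have "\<dots> = (\<integral>z. h (X z) * Y z \<partial>Q)"
    by (rule integral_cong_AE[OF _ _ eqB, symmetric]) measurable
  finally show ?thesis .
qed

end

section \<open>Central limit theorem, zero variance included\<close>

lemma char_normal_law: "char (normal_law 0 v) t = char std_normal_distribution (sqrt v * t)"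
  unfolding normal_law_def char_def by (subst integral_distr) (auto simp: mult_ac)

lemma real_distribution_normal_law: "real_distribution (normal_law \<mu> v)"
proof -
  interpret real_distribution std_normal_distribution by (rule real_dist_normal_dist)
  show ?thesis unfolding normal_law_def by (rule real_distribution_distr) measurable
qed

text \<open>With zero variance the sums vanish almost everywhere and the limit is the point mass at
  0. Otherwise the limit law of the standardised sums is rescaled through its characteristic
  function.\<close>

lemma (in iid_sample) iid_central_limit:
  fixes g :: "'z \<Rightarrow> real"
  assumes g[measurable]: "g \<in> borel_measurable D"
    and sq: "integrable D (\<lambda>z. (g z)\<^sup>2)" and mean: "(\<integral>z. g z \<partial>D) = 0"
  shows "weak_conv_m (\<lambda>m. distr M borel (\<lambda>w. (\<Sum>i<m. g (Z i w)) / sqrt (real m)))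
    (normal_law 0 (\<integral>z. (g z)\<^sup>2 \<partial>D))"
proof (rule levy_continuity[OF _ real_distribution_normal_law])
  let ?v = "\<integral>z. (g z)\<^sup>2 \<partial>D"
  let ?S = "\<lambda>m w. (\<Sum>i<m. g (Z i w)) / sqrt (real m)"
  show "real_distribution (distr M borel (?S m))" for m by (rule real_distribution_distr) measurable
  fix t :: real
  have c: "char (distr M borel f) t = expectation (\<lambda>w. iexp (t * f w))"
    if [measurable]: "f \<in> borel_measurable M" for f t
    unfolding char_def by (simp add: integral_distr)
  show "(\<lambda>m. char (distr M borel (?S m)) t) \<longlonglongrightarrow> char (normal_law 0 ?v) t"
  proof (cases "?v = 0")
    case True
    then have "AE z in D. g z = 0"
      using integral_nonneg_eq_0_iff_AE[OF sq] by auto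
    then have g0: "AE w in M. \<forall>i\<in>{..<m}. g (Z i w) = 0" for m
      using AE_Z by (intro AE_finite_allI) auto
    have AE1: "AE w in M. iexp (t * ?S m w) = 1" for m
      using g0[of m] by eventually_elim simp
    have "expectation (\<lambda>w. iexp (t * ?S m w)) = expectation (\<lambda>w. 1)" for m
      by (rule integral_cong_AE[OF _ _ AE1]) auto
    then have "char (distr M borel (?S m)) t = 1" for m
      by (simp add: c prob_space)
    moreover have "char (normal_law 0 ?v) t = 1"
      unfolding char_normal_law True
      using real_distribution.char_zero[OF real_dist_normal_dist] by simp
    ultimately show ?thesis by simp
  next
    case False
    have "0 \<le> ?v" by simp
    with False have v: "0 < ?v" by linarith
    let ?\<sigma> = "sqrt ?v"
    have ig: "integrable D g" by (rule D.square_integrable_imp_integrable[OF g sq])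
    have W: "weak_conv_m (\<lambda>m. distr M borel (\<lambda>w. (\<Sum>i<m. g (Z i w)) / sqrt (real m * ?\<sigma>\<^sup>2)))
        std_normal_distribution"
    proof (rule central_limit_theorem_zero_mean)
      show "indep_vars (\<lambda>i. borel) (\<lambda>i w. g (Z i w)) UNIV"
        by (rule indep_vars_compose2[OF indep]) simp
      show "expectation (\<lambda>w. g (Z n w)) = 0" for n by (simp add: expectation_Z mean)
      then show "variance (\<lambda>w. g (Z n w)) = ?\<sigma>\<^sup>2" for n
        by (simp add: expectation_Z[of "\<lambda>z. (g z)\<^sup>2"])
      show "?\<sigma> > 0" using v by simp
      show "integrable M (\<lambda>w. (g (Z n w))\<^sup>2)" for n using sq by (simp add: integrable_Z[of "\<lambda>z. (g z)\<^sup>2"])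
      show "distr M borel (\<lambda>w. g (Z n w)) = distr D borel g" for n
        using distr_distr[OF g Z_measurable[of n]] by (simp add: distr_Z comp_def)
    qed
    have rd: "real_distribution (distr M borel (\<lambda>w. (\<Sum>i<m. g (Z i w)) / sqrt (real m * ?\<sigma>\<^sup>2)))" for m
      by (rule real_distribution_distr) measurable
    \<comment> \<open>Evaluating the characteristic function of the standardised sum at
      \<open>?\<sigma> * t\<close> undoes the standardisation.\<close>
    have "(\<lambda>m. char (distr M borel (\<lambda>w. (\<Sum>i<m. g (Z i w)) / sqrt (real m * ?\<sigma>\<^sup>2))) (?\<sigma> * t))
        \<longlonglongrightarrow> char std_normal_distribution (?\<sigma> * t)"
      by (rule levy_continuity1[OF rd real_dist_normal_dist W])
    moreover have "char (distr M borel (\<lambda>w. (\<Sum>i<m. g (Z i w)) / sqrt (real m * ?\<sigma>\<^sup>2))) (?\<sigma> * t)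
        = char (distr M borel (?S m)) t" for m
      using v by (simp add: c real_sqrt_mult field_simps)
    ultimately show ?thesis unfolding char_normal_law by simp
  qed
qed

text \<open>The index \<open>m\<close> is the total sample size n + N. The assumption
  \<open>stieltjes\<close> says that integrand and integrator share no discontinuity, the classical
  requirement for Riemann-Stieltjes integrals; it is also what makes the value of the distribution
  function at \<open>R\<close>, rather than its left limit, a correct coefficient in
  \<open>phi_auc\<close>.\<close>

theorem corollary5p2p2:
  fixes Q :: "'q measure" and X :: "'q \<Rightarrow> real ^ 'd" and C Y R :: "'q \<Rightarrow> real"
    and M :: "'a measure" and Xs :: "nat \<Rightarrow> 'a \<Rightarrow> real ^ 'd" and Cs Ys Rs :: "nat \<Rightarrow> 'a \<Rightarrow> real"
    and k :: 'd and \<pi> f :: "real ^ 'd \<Rightarrow> real" and \<epsilon> :: real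
    and \<omega>_hat \<theta>_hat :: "nat \<Rightarrow> 'a \<Rightarrow> real" and \<theta>0 \<sigma>2 :: real
    and A B :: "'q \<Rightarrow> real"
  assumes "prob_space Q" and "prob_space M"
    and "X \<in> borel_measurable Q" "C \<in> borel_measurable Q" "Y \<in> borel_measurable Q"
    and "AE z in Q. C z \<in> {0, 1}" and "AE z in Q. Y z \<in> {0, 1}"
    and "0 < \<P>(z in Q. Y z = 1)" and "0 < \<P>(z in Q. Y z = 0)"
    and R: "\<And>z. R z = X z $ k" "\<And>i w. Rs i w = Xs i w $ k"
    and \<pi>: "\<pi> \<in> borel_measurable borel"
      "AE z in Q. cond_prob_given Q X {y \<in> space Q. C y = 1} z = \<pi> (X z)"
    and positivity: "\<epsilon> > 0" "AE z in Q. \<epsilon> < \<pi> (X z) \<and> \<pi> (X z) < 1 - \<epsilon>"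
    and MAR: "cond_indep_given Q C Y X"
    and f: "f \<in> borel_measurable borel" "AE z in Q. f (X z) \<ge> 0"
      "integrable Q (\<lambda>z. (f (X z))\<^sup>2)"
      "(\<integral>z. f (X z) \<partial>Q) * (1 - (\<integral>z. f (X z) \<partial>Q)) \<noteq> 0"
    and stieltjes:
      "\<And>\<alpha>. isCont (\<lambda>a. \<P>(z in Q. R z \<le> a \<bar> Y z = 1)) \<alpha> \<or>
            isCont (\<lambda>a. \<P>(z in Q. R z \<le> a \<bar> Y z = 0)) \<alpha>"
      "\<And>\<alpha>. isCont (pop_wcdf Q R (\<lambda>z. f (X z))) \<alpha> \<or>
            isCont (pop_wcdf Q R (\<lambda>z. 1 - f (X z))) \<alpha>"
    and iid: "prob_space.indep_vars M (\<lambda>_. borel) (\<lambda>i w. (Xs i w, Cs i w, Ys i w)) UNIV"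
      "\<And>i. distr M borel (\<lambda>w. (Xs i w, Cs i w, Ys i w)) = distr Q borel (\<lambda>z. (X z, C z, Y z))"
    and A: "\<And>z. A z = C z / \<pi> (X z) * phi_auc Q R Y (R z) (Y z)"
    and B: "\<And>z. B z = (1 - C z / \<pi> (X z)) * phi_auc Q R (\<lambda>y. f (X y)) (R z) (f (X z))"
    and \<omega>_hat: "\<And>m. \<omega>_hat m \<in> borel_measurable M"
      "converges_in_prob M \<omega>_hat
         (covariance Q A
            (\<lambda>z. (C z / \<pi> (X z) - 1) * phi_auc Q R (\<lambda>y. f (X y)) (R z) (f (X z)))
          / prob_space.variance Q B)"
    and \<theta>0: "\<theta>0 = stieltjes_integral (\<lambda>\<alpha>. \<P>(z in Q. R z > \<alpha> \<bar> Y z = 1))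
                                    (\<lambda>\<alpha>. \<P>(z in Q. R z \<le> \<alpha> \<bar> Y z = 0))"
    and \<theta>_hat: "\<And>m w. \<theta>_hat m w =
         auc_hat m (\<lambda>i. Cs i w / \<pi> (Xs i w)) (\<lambda>i. Rs i w) (\<lambda>i. Ys i w)
         + \<omega>_hat m w *
           (auc_hat m (\<lambda>i. 1) (\<lambda>i. Rs i w) (\<lambda>i. f (Xs i w))
            - auc_hat m (\<lambda>i. Cs i w / \<pi> (Xs i w)) (\<lambda>i. Rs i w) (\<lambda>i. f (Xs i w)))"
    and \<sigma>2: "\<sigma>2 = prob_space.variance Q A
                   - (covariance Q A B)\<^sup>2 / prob_space.variance Q B"
  shows "weak_conv_m (\<lambda>m. distr M borel (\<lambda>w. sqrt (real m) * (\<theta>_hat m w - \<theta>0)))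
           (normal_law 0 \<sigma>2)"
proof -
  interpret Q: prob_space Q by fact
  interpret M: prob_space M by fact
  note XCY[measurable] = assms(3-5)
  note [measurable] = \<pi>(1) f(1)
  interpret mar: missing_at_random Q X C Y \<pi> \<epsilon>
    by unfold_locales (use assms(3-7) \<pi> positivity MAR in auto)
  \<comment> \<open>\<open>G\<close> and each \<open>Z i\<close> have the same law \<open>D\<close>,
    so an identity proved for integrals over \<open>Q\<close> can be used for the sample on
    \<open>M\<close>.\<close>
  define G where "G z = (X z, C z, Y z)" for z
  define Z where "Z i w = (Xs i w, Cs i w, Ys i w)" for i w
  have G[measurable]: "G \<in> measurable Q borel" unfolding G_def by measurable
  have iid': "prob_space.indep_vars M (\<lambda>_. borel) Z UNIV" "distr M borel (Z i) = distr Q borel G" for i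
    using iid by (simp_all add: Z_def[abs_def] G_def[abs_def])
  define D where "D = distr Q borel G"
  have [measurable_cong]: "sets D = sets borel" by (simp add: D_def)
  interpret iid_sample M D Z
  proof
    show "M.indep_vars (\<lambda>_. D) Z UNIV"
      using iid'(1) unfolding M.indep_vars_def
      by (simp add: measurable_cong_sets[OF refl \<open>sets D = sets borel\<close>] \<open>sets D = sets borel\<close>)
    show "distr M D (Z i) = D" for i
      using iid'(2)[of i] unfolding D_def by (metis distr_cong sets_distr)
  qed

  define w t g r :: "(real ^ 'd) \<times> real \<times> real \<Rightarrow> real"
    where "w = (\<lambda>(x, c, y). c / \<pi> x)" and "t = (\<lambda>(x, c, y). y)" and "g = (\<lambda>(x, c, y). f x)"
      and "r = (\<lambda>(x, c, y). x $ k)"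
  have on_G: "w (G z) = C z / \<pi> (X z)" "t (G z) = Y z" "g (G z) = f (X z)" "r (G z) = R z" for z
    by (simp_all add: w_def t_def g_def r_def G_def R)
  have on_Z: "w (Z i x) = Cs i x / \<pi> (Xs i x)" "t (Z i x) = Ys i x" "g (Z i x) = f (Xs i x)" "r (Z i x) = Rs i x" for i x
    by (simp_all add: w_def t_def g_def r_def Z_def R)
  have [measurable]: "(\<lambda>x :: real ^ 'd. x $ k) \<in> borel_measurable borel"
    by (intro borel_measurable_continuous_onI continuous_intros)
  have borel_m: "w \<in> borel_measurable borel" "t \<in> borel_measurable borel"
      "g \<in> borel_measurable borel" "r \<in> borel_measurable borel"
    unfolding w_def t_def g_def r_def borel_prod[symmetric] by measurable
  note [measurable] = this
  have Rm[measurable]: "R \<in> borel_measurable Q"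
    using measurable_compose[OF G borel_m(4)] by (simp add: on_G)
  have int_D: "(\<integral>z. h z \<partial>D) = (\<integral>z. h (G z) \<partial>Q)" if [measurable]: "h \<in> borel_measurable borel" for h :: "_ \<Rightarrow> real"
    unfolding D_def by (simp add: integral_distr)
  have integrable_D: "integrable D h \<longleftrightarrow> integrable Q (\<lambda>z. h (G z))" if [measurable]: "h \<in> borel_measurable borel" for h :: "_ \<Rightarrow> real"
    unfolding D_def by (simp add: integrable_distr_eq)
  have phi_D: "phi_auc D r t = phi_auc Q R Y" "phi_auc D r g = phi_auc Q R (\<lambda>y. f (X y))"
    unfolding D_def by (simp_all add: phi_auc_distr on_G)
  have pop_D: "pop_wcdf D r t = pop_wcdf Q R Y" "pop_wcdf D r g = pop_wcdf Q R (\<lambda>y. f (X y))"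
    "pop_wcdf D r (\<lambda>z. 1 - t z) = pop_wcdf Q R (\<lambda>z. 1 - Y z)"
    "pop_wcdf D r (\<lambda>z. 1 - g z) = pop_wcdf Q R (\<lambda>z. 1 - f (X z))"
    unfolding D_def by (simp_all add: pop_wcdf_distr on_G)

  have AE_D: "AE z in D. P z" if "Measurable.pred borel P" "AE z in Q. P (G z)" for P
    unfolding D_def using that by (subst AE_distr_iff) auto
  have w_le: "AE z in D. \<bar>w z\<bar> \<le> 1 / \<epsilon>"
    by (rule AE_D) (use mar.weight_bounded in \<open>simp_all add: on_G\<close>)
  have Y_le: "AE z in Q. \<bar>Y z\<bar> \<le> 1" using assms(7) by eventually_elim auto
  have iY: "integrable Q Y" and sqY: "integrable Q (\<lambda>z. (Y z)\<^sup>2)"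
    using Y_le by (auto intro!: Q.integrable_const_bound[where B = 1] simp: power_le_one abs_square_le_1)
  have if': "integrable Q (\<lambda>z. f (X z))"
    by (rule Q.square_integrable_imp_integrable[OF _ f(3)]) measurable
  have pY: "(\<integral>z. Y z \<partial>Q) \<noteq> 0" "(\<integral>z. 1 - Y z \<partial>Q) \<noteq> 0"
    using assms(8,9) Q.cond_prob_eq_pop_wcdf(4,5)[OF Rm XCY(3) assms(7)] by simp_all
  have pf: "(\<integral>z. f (X z) \<partial>Q) \<noteq> 0" "(\<integral>z. 1 - f (X z) \<partial>Q) \<noteq> 0"
    using f(4) if' by (simp_all add: Q.prob_space)
  have jumpY: "(\<integral>y. (if R y = s then Y y else 0) \<partial>Q) = 0 \<or> (\<integral>y. (if R y = s then 1 - Y y else 0) \<partial>Q) = 0" for s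
    using stieltjes(1)[of s] isCont_pop_wcdf_no_jump[OF Rm iY pY(1), of s]
      isCont_pop_wcdf_no_jump[OF Rm _ pY(2), of s] iY
    unfolding Q.cond_prob_eq_pop_wcdf(1,3)[OF Rm XCY(3) assms(7)] by auto
  have jumpf: "(\<integral>y. (if R y = s then f (X y) else 0) \<partial>Q) = 0 \<or>
      (\<integral>y. (if R y = s then 1 - f (X y) else 0) \<partial>Q) = 0" for s
    using stieltjes(2)[of s] isCont_pop_wcdf_no_jump[OF Rm if' pf(1), of s]
      isCont_pop_wcdf_no_jump[OF Rm _ pf(2), of s] if' by auto

  \<comment> \<open>As \<open>R\<close> is a coordinate of \<open>X\<close>, the factor
    \<open>h (R z) * v (X z)\<close> is a function of \<open>X\<close>, and
    \<open>integral_weight\<close> applies to it.\<close>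
  have ipw: "(\<integral>z. h (R z) * (C z / \<pi> (X z) * v (X z)) \<partial>Q) = (\<integral>z. h (R z) * v (X z) \<partial>Q)"
    if [measurable]: "h \<in> borel_measurable borel" "v \<in> borel_measurable borel"
      and h: "\<And>s. \<bar>h s\<bar> \<le> K" and v: "integrable Q (\<lambda>z. v (X z))" for h v K
  proof -
    have "integrable Q (\<lambda>z. h (R z) * v (X z))"
    proof (rule Bochner_Integration.integrable_bound)
      show "integrable Q (\<lambda>z. K * v (X z))" using v by simp
      have "\<bar>h s\<bar> \<le> \<bar>K\<bar>" for s using h[of s] by linarith
      then show "AE z in Q. norm (h (R z) * v (X z)) \<le> norm (K * v (X z))"
        by (auto simp: abs_mult intro!: mult_right_mono)
    qed measurable
    then have "(\<integral>z. C z / \<pi> (X z) * (h (X z $ k) * v (X z)) \<partial>Q) = (\<integral>z. h (X z $ k) * v (X z) \<partial>Q)"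
      by (intro mar.integral_weight) (simp_all add: R)
    then show ?thesis by (simp add: R mult_ac)
  qed
  have ipwY: "(\<integral>z. h (R z) * (C z / \<pi> (X z) * Y z) \<partial>Q) = (\<integral>z. h (R z) * Y z \<partial>Q)"
    if [measurable]: "h \<in> borel_measurable borel" and h: "\<And>s. \<bar>h s\<bar> \<le> K" for h K
  proof -
    have "integrable Q (\<lambda>z. h (R z))"
      by (rule Q.integrable_const_bound[where B = K]) (use h in auto)
    then have "(\<integral>z. C z / \<pi> (X z) * (h (X z $ k) * Y z) \<partial>Q) = (\<integral>z. h (X z $ k) * Y z \<partial>Q)"
      by (intro mar.integral_weight_Y) (simp_all add: R)
    then show ?thesis by (simp add: R mult_ac)
  qed
  have ipwY': "(\<integral>z. h (R z) * (C z / \<pi> (X z) * (1 - Y z)) \<partial>Q) = (\<integral>z. h (R z) * (1 - Y z) \<partial>Q)"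
    if [measurable]: "h \<in> borel_measurable borel" and h: "\<And>s. \<bar>h s\<bar> \<le> K" for h K
  proof -
    have K: "0 \<le> K" using h[of 0] by linarith
    \<comment> \<open>Splitting \<open>1 - Y\<close> needs integrability of each piece; this bound
      is used with the inverse probability weight, where \<open>L = 1 / \<epsilon>\<close>, and with
      the constant weight, where \<open>L = 1\<close>.\<close>
    have bnd: "integrable Q (\<lambda>z. h (R z) * (u z * y z))"
      if [measurable]: "u \<in> borel_measurable Q" "y \<in> borel_measurable Q"
        and u: "AE z in Q. \<bar>u z\<bar> \<le> L" and y: "AE z in Q. \<bar>y z\<bar> \<le> 1" for u y L
    proof (rule Q.integrable_const_bound[where B = "K * L"])
      show "AE z in Q. norm (h (R z) * (u z * y z)) \<le> K * L"
        using u y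
      proof eventually_elim
        case (elim z)
        have "\<bar>u z\<bar> * \<bar>y z\<bar> \<le> L * 1" using elim by (intro mult_mono) auto
        then have "\<bar>h (R z)\<bar> * (\<bar>u z\<bar> * \<bar>y z\<bar>) \<le> K * L" using h K by (intro mult_mono) auto
        then show ?case by (simp add: abs_mult)
      qed
    qed measurable
    have i: "integrable Q (\<lambda>z. h (R z) * (C z / \<pi> (X z) * Y z))"
        "integrable Q (\<lambda>z. h (R z) * (C z / \<pi> (X z) * 1))"
      by (intro bnd[OF _ _ mar.weight_bounded] Y_le; simp)+
    have i': "integrable Q (\<lambda>z. h (R z) * (1 * Y z))" "integrable Q (\<lambda>z. h (R z) * (1 * 1))"
      by (rule bnd[of "\<lambda>_. 1" _ 1]; use Y_le in simp)+
    have one: "(\<integral>z. h (R z) * (C z / \<pi> (X z) * 1) \<partial>Q) = (\<integral>z. h (R z) * 1 \<partial>Q)"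
      by (rule ipw[OF that(1) _ h]) auto
    have "(\<integral>z. h (R z) * (C z / \<pi> (X z) * (1 - Y z)) \<partial>Q)
        = (\<integral>z. h (R z) * (C z / \<pi> (X z) * 1) - h (R z) * (C z / \<pi> (X z) * Y z) \<partial>Q)"
      by (simp only: right_diff_distrib)
    also have "\<dots> = (\<integral>z. h (R z) * 1 \<partial>Q) - (\<integral>z. h (R z) * Y z \<partial>Q)"
      unfolding Bochner_Integration.integral_diff[OF i(2,1)] ipwY[OF that(1) h] one ..
    also have "\<dots> = (\<integral>z. h (R z) * 1 - h (R z) * Y z \<partial>Q)"
      using Bochner_Integration.integral_diff[OF i'(2,1)] by simp
    finally show ?thesis by (simp add: algebra_simps)
  qed

  define \<Phi>1 \<Phi>2 \<Phi>3 where "\<Phi>1 z = w z * phi_auc D r t (r z) (t z)"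
    and "\<Phi>2 z = phi_auc D r g (r z) (g z)" and "\<Phi>3 z = w z * phi_auc D r g (r z) (g z)" for z
  \<comment> \<open>The common centring of the two \<open>f\<close>-based estimators. It cancels in
    their difference, so its value may differ from \<open>\<theta>0\<close>.\<close>
  define \<theta>f where "\<theta>f = stieltjes_integral (\<lambda>\<alpha>. 1 - pop_wcdf D r g \<alpha>) (pop_wcdf D r (\<lambda>z. 1 - g z))"
  have \<theta>0': "\<theta>0 = stieltjes_integral (\<lambda>\<alpha>. 1 - pop_wcdf D r t \<alpha>) (pop_wcdf D r (\<lambda>z. 1 - t z))"
    unfolding \<theta>0 pop_D one_minus_pop_wcdf[OF Rm iY pY(1)]
      Q.cond_prob_eq_pop_wcdf(2,3)[OF Rm XCY(3) assms(7)] ..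
  define V1 V2 V3 where
    "V1 m x = sqrt (real m) * (auc_hat m (\<lambda>i. w (Z i x)) (\<lambda>i. r (Z i x)) (\<lambda>i. t (Z i x)) - \<theta>0)"
    and "V2 m x = sqrt (real m) * (auc_hat m (\<lambda>i. 1) (\<lambda>i. r (Z i x)) (\<lambda>i. g (Z i x)) - \<theta>f)"
    and "V3 m x = sqrt (real m) * (auc_hat m (\<lambda>i. w (Z i x)) (\<lambda>i. r (Z i x)) (\<lambda>i. g (Z i x)) - \<theta>f)" for m x
  define L where "L h m x = (\<Sum>i<m. h (Z i x)) / sqrt (real m)" for h :: "_ \<Rightarrow> real" and m x
  have t0: "AE z in D. 0 \<le> t z"
    by (rule AE_D) (use assms(7) in \<open>auto simp: on_G\<close>)
  have g0: "AE z in D. 0 \<le> g z"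
    by (rule AE_D) (use f(2) in \<open>auto simp: on_G\<close>)
  have sqt: "integrable D (\<lambda>z. (t z)\<^sup>2)" and sqg: "integrable D (\<lambda>z. (g z)\<^sup>2)"
    using sqY f(3) by (simp_all add: integrable_D on_G)
  have pt: "(\<integral>z. t z \<partial>D) \<noteq> 0" "(\<integral>z. 1 - t z \<partial>D) \<noteq> 0" and pg: "(\<integral>z. g z \<partial>D) \<noteq> 0" "(\<integral>z. 1 - g z \<partial>D) \<noteq> 0"
    using pY pf by (simp_all add: int_D on_G)
  have jt: "(\<integral>y. (if r y = s then t y else 0) \<partial>D) = 0 \<or> (\<integral>y. (if r y = s then 1 - t y else 0) \<partial>D) = 0"
    and jg: "(\<integral>y. (if r y = s then g y else 0) \<partial>D) = 0 \<or> (\<integral>y. (if r y = s then 1 - g y else 0) \<partial>D) = 0" for s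
    using jumpY[of s] jumpf[of s] by (simp_all add: int_D on_G cong: if_cong)
  have lift: "(\<integral>z. h1 z \<partial>D) = (\<integral>z. h2 z \<partial>D)"
    if "h1 \<in> borel_measurable borel" "h2 \<in> borel_measurable borel"
      and "(\<integral>z. h1 (G z) \<partial>Q) = (\<integral>z. h2 (G z) \<partial>Q)" for h1 h2 :: "_ \<Rightarrow> real"
    using that by (simp only: int_D)
  have unbiased:
    "(\<integral>z. h (r z) * (w z * t z) \<partial>D) = (\<integral>z. h (r z) * t z \<partial>D)"
    "(\<integral>z. h (r z) * (w z * (1 - t z)) \<partial>D) = (\<integral>z. h (r z) * (1 - t z) \<partial>D)"
    "(\<integral>z. h (r z) * (w z * g z) \<partial>D) = (\<integral>z. h (r z) * g z \<partial>D)"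
    "(\<integral>z. h (r z) * (w z * (1 - g z)) \<partial>D) = (\<integral>z. h (r z) * (1 - g z) \<partial>D)"
    if h[measurable]: "h \<in> borel_measurable borel" and h_le: "\<And>s. \<bar>h s\<bar> \<le> K" for h K
  proof -
    have 1: "integrable Q (\<lambda>z. 1 - f (X z))" using if' by simp
    show "(\<integral>z. h (r z) * (w z * t z) \<partial>D) = (\<integral>z. h (r z) * t z \<partial>D)"
      by (rule lift; ((unfold on_G, rule ipwY[OF h h_le]) | measurable))
    show "(\<integral>z. h (r z) * (w z * (1 - t z)) \<partial>D) = (\<integral>z. h (r z) * (1 - t z) \<partial>D)"
      by (rule lift; ((unfold on_G, rule ipwY'[OF h h_le]) | measurable))
    show "(\<integral>z. h (r z) * (w z * g z) \<partial>D) = (\<integral>z. h (r z) * g z \<partial>D)"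
      by (rule lift; ((unfold on_G, rule ipw[OF h f(1) h_le if']) | measurable))
    show "(\<integral>z. h (r z) * (w z * (1 - g z)) \<partial>D) = (\<integral>z. h (r z) * (1 - g z) \<partial>D)"
      by (rule lift; ((unfold on_G, rule ipw[OF h _ h_le 1], measurable) | measurable))
  qed
  have mD: "w \<in> borel_measurable D" "t \<in> borel_measurable D" "g \<in> borel_measurable D" "r \<in> borel_measurable D"
    by measurable
  have one_le: "AE z in D. \<bar>1\<bar> \<le> (1::real)" by simp
  have \<Phi>1: "\<Phi>1 \<in> borel_measurable D" "integrable D (\<lambda>z. (\<Phi>1 z)\<^sup>2)" "(\<integral>z. \<Phi>1 z \<partial>D) = 0"
    "converges_in_prob M (\<lambda>m x. V1 m x - L \<Phi>1 m x) 0"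
    unfolding \<Phi>1_def[abs_def] V1_def L_def \<theta>0'
    by (rule auc_hat_linearization[OF mD(1,2,4) w_le sqt t0 pt]; fact unbiased jt)+
  have \<Phi>2: "\<Phi>2 \<in> borel_measurable D" "integrable D (\<lambda>z. (\<Phi>2 z)\<^sup>2)" "(\<integral>z. \<Phi>2 z \<partial>D) = 0"
    "converges_in_prob M (\<lambda>m x. V2 m x - L \<Phi>2 m x) 0"
    unfolding \<Phi>2_def[abs_def] V2_def L_def \<theta>f_def
    \<comment> \<open>With the constant weight 1, both unbiasedness conditions become reflexive
      after \<open>mult_1\<close>.\<close>
    by (rule auc_hat_linearization[OF borel_measurable_const mD(3,4) one_le sqg g0 pg, unfolded mult_1];
        (rule refl | fact jg))+
  have \<Phi>3: "\<Phi>3 \<in> borel_measurable D" "integrable D (\<lambda>z. (\<Phi>3 z)\<^sup>2)" "(\<integral>z. \<Phi>3 z \<partial>D) = 0"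
    "converges_in_prob M (\<lambda>m x. V3 m x - L \<Phi>3 m x) 0"
    unfolding \<Phi>3_def[abs_def] V3_def L_def \<theta>f_def
    by (rule auc_hat_linearization[OF mD(1,3,4) w_le sqg g0 pg]; fact unbiased jg)+
  define \<omega>0 where "\<omega>0 = covariance Q A
      (\<lambda>z. (C z / \<pi> (X z) - 1) * phi_auc Q R (\<lambda>y. f (X y)) (R z) (f (X z))) / Q.variance B"
  have D_eq: "measurable D borel = (measurable borel borel :: (_ \<Rightarrow> real) set)"
    by (rule measurable_cong_sets) (simp_all add: D_def)
  note [measurable] = \<omega>_hat(1) \<Phi>1(1)[unfolded D_eq] \<Phi>2(1)[unfolded D_eq] \<Phi>3(1)[unfolded D_eq]
  have L_m[measurable]: "L h m \<in> borel_measurable M" if "h \<in> borel_measurable D" for h m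
    using that unfolding L_def[abs_def] by measurable
  have [measurable]: "Z i \<in> measurable M borel" for i
    using Z_measurable[of i] by (simp add: measurable_cong_sets[OF refl \<open>sets D = sets borel\<close>])
  have V_m[measurable]: "V1 m \<in> borel_measurable M" "V2 m \<in> borel_measurable M" "V3 m \<in> borel_measurable M" for m
    unfolding V1_def[abs_def] V2_def[abs_def] V3_def[abs_def] by measurable

  \<comment> \<open>\<open>b\<close> is the influence function of the difference of the two
    \<open>f\<close>-based estimators; \<open>H\<close> is that of the full estimator with
    \<open>\<omega>_hat\<close> replaced by its limit.\<close>
  define b where "b z = \<Phi>2 z - \<Phi>3 z" for z
  define H where "H z = \<Phi>1 z + \<omega>0 * b z" for z
  have bm[measurable]: "b \<in> borel_measurable D" and Hm[measurable]: "H \<in> borel_measurable D"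
    unfolding D_eq H_def[abs_def] b_def[abs_def] by measurable
  note [measurable] = bm[unfolded D_eq] Hm[unfolded D_eq]
  have sqb: "integrable D (\<lambda>z. (b z)\<^sup>2)"
    using integrable_square_add[of \<Phi>2 D "\<lambda>z. - \<Phi>3 z"] \<Phi>2(2) \<Phi>3(2) by (simp add: b_def)
  have sqH: "integrable D (\<lambda>z. (H z)\<^sup>2)"
    using integrable_square_add[of \<Phi>1 D "\<lambda>z. \<omega>0 * b z"] \<Phi>1(2) sqb by (simp add: H_def power_mult_distrib)
  have i\<Phi>: "integrable D \<Phi>1" "integrable D \<Phi>2" "integrable D \<Phi>3"
    using \<Phi>1(2) \<Phi>2(2) \<Phi>3(2) by (auto intro: D.square_integrable_imp_integrable[rotated])
  have mean_b: "(\<integral>z. b z \<partial>D) = 0" unfolding b_def using i\<Phi> \<Phi>2(3) \<Phi>3(3) by simp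
  have ib: "integrable D b" by (rule D.square_integrable_imp_integrable[OF bm sqb])
  have mean_H: "(\<integral>z. H z \<partial>D) = 0" unfolding H_def using i\<Phi> ib mean_b \<Phi>1(3) by simp

  have \<Phi>1_G: "\<Phi>1 (G z) = A z" and b_G: "b (G z) = B z" for z
    by (simp_all add: \<Phi>1_def b_def \<Phi>2_def \<Phi>3_def on_G A B phi_D left_diff_distrib)
  define c where "c = (\<integral>z. \<Phi>1 z * b z \<partial>D)"
  define vA where "vA = (\<integral>z. (\<Phi>1 z)\<^sup>2 \<partial>D)"
  define vB where "vB = (\<integral>z. (b z)\<^sup>2 \<partial>D)"
  have EA: "(\<integral>z. A z \<partial>Q) = 0" and EB: "(\<integral>z. B z \<partial>Q) = 0"
    using \<Phi>1(3) mean_b by (simp_all add: int_D \<Phi>1_G b_G)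
  have vars: "Q.variance A = vA" "Q.variance B = vB" "covariance Q A B = c"
    unfolding covariance_def EA EB vA_def vB_def c_def by (simp_all add: int_D \<Phi>1_G b_G)
  \<comment> \<open>The limit of \<open>\<omega>_hat\<close> is stated with
    \<open>C / \<pi> - 1\<close>, whereas \<open>B\<close> contains \<open>1 - C / \<pi>\<close>;
    this is the origin of the minus sign in \<open>\<omega>0\<close>.\<close>
  have "covariance Q A (\<lambda>z. (C z / \<pi> (X z) - 1) * phi_auc Q R (\<lambda>y. f (X y)) (R z) (f (X z))) = - c"
  proof -
    have "(C z / \<pi> (X z) - 1) * phi_auc Q R (\<lambda>y. f (X y)) (R z) (f (X z)) = - B z" for z
      by (simp add: B algebra_simps)
    then have "covariance Q A (\<lambda>z. (C z / \<pi> (X z) - 1) * phi_auc Q R (\<lambda>y. f (X y)) (R z) (f (X z)))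
        = covariance Q A (\<lambda>z. - B z)" by simp
    also have "\<dots> = - covariance Q A B" unfolding covariance_def by (simp add: EA EB)
    finally show ?thesis by (simp add: vars)
  qed
  then have \<omega>0: "\<omega>0 = - c / vB" by (simp add: \<omega>0_def vars)
  \<comment> \<open>For \<open>vB > 0\<close>, \<open>\<omega>0\<close> minimises the quadratic
    \<open>vA + 2 * \<omega> * c + \<omega>\<^sup>2 * vB\<close> in \<open>\<omega>\<close>, and
    \<open>vA - c\<^sup>2 / vB\<close> is the minimum.\<close>
  have var_H: "(\<integral>z. (H z)\<^sup>2 \<partial>D) = \<sigma>2"
  proof -
    have ic: "integrable D (\<lambda>z. \<Phi>1 z * b z)"
      by (rule integrable_mult_of_squares[OF _ _ \<Phi>1(2) sqb]) measurable
    have "(\<integral>z. (H z)\<^sup>2 \<partial>D) = (\<integral>z. (\<Phi>1 z)\<^sup>2 + 2 * \<omega>0 * (\<Phi>1 z * b z) + \<omega>0\<^sup>2 * (b z)\<^sup>2 \<partial>D)"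
      by (simp add: H_def power2_sum power_mult_distrib algebra_simps)
    also have "\<dots> = vA + 2 * \<omega>0 * c + \<omega>0\<^sup>2 * vB"
      using \<Phi>1(2) sqb ic by (simp add: vA_def vB_def c_def)
    also have "\<dots> = vA - c\<^sup>2 / vB"
      by (cases "vB = 0") (simp_all add: \<omega>0 field_simps power2_eq_square)
    finally show ?thesis by (simp add: \<sigma>2 vars)
  qed

  have W: "sqrt (real m) * (\<theta>_hat m x - \<theta>0) = V1 m x + \<omega>_hat m x * (V2 m x - V3 m x)" for m x
    by (simp add: \<theta>_hat V1_def V2_def V3_def on_Z algebra_simps)
  have Lb: "L b m x = L \<Phi>2 m x - L \<Phi>3 m x" for m x
    by (simp add: L_def b_def sum_subtractf diff_divide_distrib)
  have LH: "L H m x = L \<Phi>1 m x + \<omega>0 * L b m x" for m x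
    by (simp add: L_def H_def sum.distrib add_divide_distrib flip: sum_distrib_left)
  have \<omega>: "converges_in_prob M \<omega>_hat \<omega>0" using \<omega>_hat(2) by (simp add: \<omega>0_def)
  \<comment> \<open>Besides the error in \<open>V1\<close>, two errors remain: the linearisation
    errors of \<open>V2\<close> and \<open>V3\<close>, multiplied by the convergent
    \<open>\<omega>_hat\<close>, and the error of replacing \<open>\<omega>_hat\<close> by
    \<open>\<omega>0\<close>, multiplied by the sum \<open>L b\<close>, which is bounded in
    probability because \<open>b\<close> has mean zero.\<close>
  have "converges_in_prob M (\<lambda>m x. (V2 m x - L \<Phi>2 m x) - (V3 m x - L \<Phi>3 m x)) (0 - 0)"
    by (intro M.converges_in_prob_diff \<Phi>2(4) \<Phi>3(4)) measurable
  then have 1: "converges_in_prob M (\<lambda>m x. \<omega>_hat m x * ((V2 m x - L \<Phi>2 m x) - (V3 m x - L \<Phi>3 m x))) (\<omega>0 * (0 - 0))"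
    by (intro M.converges_in_prob_mult \<omega>) measurable
  have "converges_in_prob M (\<lambda>m x. \<omega>_hat m x - \<omega>0) (\<omega>0 - \<omega>0)"
    by (rule M.converges_in_prob_diff[OF _ _ \<omega>]) (auto simp: converges_in_prob_def)
  then have 2: "converges_in_prob M (\<lambda>m x. (\<omega>_hat m x - \<omega>0) * L b m x) 0"
    using scaled_sum_bounded_in_prob[OF bm sqb mean_b]
    by (intro M.converges_in_prob_mult_bounded) (simp_all add: L_def[abs_def])
  have "converges_in_prob M (\<lambda>m x. (V1 m x - L \<Phi>1 m x) +
      (\<omega>_hat m x * ((V2 m x - L \<Phi>2 m x) - (V3 m x - L \<Phi>3 m x)) + (\<omega>_hat m x - \<omega>0) * L b m x))
      (0 + (\<omega>0 * (0 - 0) + 0))"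
    by (intro M.converges_in_prob_add \<Phi>1(4) 1 2) measurable
  moreover have "(V1 m x - L \<Phi>1 m x) +
      (\<omega>_hat m x * ((V2 m x - L \<Phi>2 m x) - (V3 m x - L \<Phi>3 m x)) + (\<omega>_hat m x - \<omega>0) * L b m x)
      = sqrt (real m) * (\<theta>_hat m x - \<theta>0) - L H m x" for m x
    unfolding W LH Lb by (simp add: algebra_simps)
  ultimately have close: "converges_in_prob M (\<lambda>m x. sqrt (real m) * (\<theta>_hat m x - \<theta>0) - L H m x) 0"
    by simp
  have "weak_conv_m (\<lambda>m. distr M borel (L H m)) (normal_law 0 \<sigma>2)"
    using iid_central_limit[OF Hm sqH mean_H] unfolding var_H L_def[abs_def] .
  then show ?thesis
    by (rule M.weak_conv_m_slutsky[OF _ _ _ real_distribution_normal_law close, rotated 2])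
      (unfold W, measurable)
qed

end
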